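(* Let $\mathfrak{a},\mathfrak{b}>0$ be real, $\omega_1=\mathfrak{a}-i\mathfrak{b}$, $\omega_2=\mathfrak{a}+i\mathfrak{b}$, $\Lambda=\{2m\omega_1+2n\omega_2: m,n\in\mathbb{Z}\}$, and let $\mathfrak{c}$ and the symmetric zeta-function $\zeta$ be the constant and function attached to $\Lambda$ as in the context. Let $\hat{\mathbb{R}}=\mathbb{R}\cup\{\infty\}$ and let $\mathfrak{Z}:\mathbb{C}\to\hat{\mathbb{R}}$ be given by $$\mathfrak{Z}(w)=-\frac{1}{2\pi}\,\mathrm{Re}\int_0^{w}\mathfrak{c}\,\zeta(z)\,dz .$$ Then there exist unique real constants $A,B,C$, depending only on $(\mathfrak{a},\mathfrak{b})$, such that the function $\hat{\mathfrak{Z}}:\mathbb{C}\to\hat{\mathbb{R}}$ defined by $$\hat{\mathfrak{Z}}(z):=\mathfrak{Z}(z)+Ax^2+By^2+Cxy,\qquad x=\mathrm{Re}\,z,\ y=\mathrm{Im}\,z,$$ is a real-analytic (away from the points where it takes the value $\infty$) doubly-periodic function, with periods $2\omega_1$ and $2\omega_2$.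
   Context: Let $\boldsymbol{\wp}$ denote the classical Weierstrass P-function of $\Lambda$, $$\boldsymbol{\wp}(z)=\frac1{z^2}+\sum_{\lambda\in\Lambda\setminus\{0\}}\Bigl(\frac1{(z-\lambda)^2}-\frac1{\lambda^2}\Bigr).$$ Put $e_1=\boldsymbol{\wp}(\omega_1)$, $e_2=\boldsymbol{\wp}(\omega_2)$, $e_3=\boldsymbol{\wp}(\omega_1+\omega_2)$. Let $\mathfrak{c}$ be the square root of $(e_1-e_3)(e_3-e_2)$ with $\mathfrak{c}=-i|\mathfrak{c}|$. Karcher's symmetric Weierstrass P-function is $$\wp(z)=\frac{\boldsymbol{\wp}(z-\omega_1-\omega_2)-e_3}{\mathfrak{c}},\qquad z\in\mathbb{C},$$ which has a double zero at $0$ and double poles exactly at the points of $\omega_1+\omega_2+\Lambda=2\mathfrak{a}+\Lambda$. The symmetric zeta-function is its primitive $\zeta(z)=-\int_0^z\wp(u)\,du$, a meromorphic function on $\mathbb{C}$ with simple poles at the points of $2\mathfrak{a}+\Lambda$. In the definition of $\mathfrak{Z}$, integration is along any path from $0$ to $w$ avoiding the poles of $\zeta$ (the real part does not depend on the path), and $\mathfrak{Z}$ takes the value $\infty$ at the points of $2\mathfrak{a}+\Lambda$. *)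

theory Defs
  imports "HOL-Complex_Analysis.Complex_Analysis"
begin

definition period_lattice :: "complex \<Rightarrow> complex \<Rightarrow> complex set" where
  "period_lattice \<omega>\<^sub>1 \<omega>\<^sub>2 = {2 * of_int m * \<omega>\<^sub>1 + 2 * of_int n * \<omega>\<^sub>2 |m n. True}"

text \<open>The series converges absolutely off the lattice; the value at lattice points is irrelevant.\<close>

definition weierstrass_p :: "complex set \<Rightarrow> complex \<Rightarrow> complex" where
  "weierstrass_p \<Lambda> z = 1 / z\<^sup>2 + (\<Sum>\<^sub>\<infinity>l\<in>\<Lambda> - {0}. 1 / (z - l)\<^sup>2 - 1 / l\<^sup>2)"

definition e\<^sub>1 :: "complex \<Rightarrow> complex \<Rightarrow> complex" where
  "e\<^sub>1 \<omega>\<^sub>1 \<omega>\<^sub>2 = weierstrass_p (period_lattice \<omega>\<^sub>1 \<omega>\<^sub>2) \<omega>\<^sub>1"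

definition e\<^sub>2 :: "complex \<Rightarrow> complex \<Rightarrow> complex" where
  "e\<^sub>2 \<omega>\<^sub>1 \<omega>\<^sub>2 = weierstrass_p (period_lattice \<omega>\<^sub>1 \<omega>\<^sub>2) \<omega>\<^sub>2"

definition e\<^sub>3 :: "complex \<Rightarrow> complex \<Rightarrow> complex" where
  "e\<^sub>3 \<omega>\<^sub>1 \<omega>\<^sub>2 = weierstrass_p (period_lattice \<omega>\<^sub>1 \<omega>\<^sub>2) (\<omega>\<^sub>1 + \<omega>\<^sub>2)"

text \<open>If \<open>\<omega>\<^sub>2\<close> is the complex conjugate of \<open>\<omega>\<^sub>1\<close>, the product below is a nonpositive real number, so
  such a square root exists and is unique.\<close>

definition karcher_const :: "complex \<Rightarrow> complex \<Rightarrow> complex" where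
  "karcher_const \<omega>\<^sub>1 \<omega>\<^sub>2 =
     (THE c. c\<^sup>2 = (e\<^sub>1 \<omega>\<^sub>1 \<omega>\<^sub>2 - e\<^sub>3 \<omega>\<^sub>1 \<omega>\<^sub>2) * (e\<^sub>3 \<omega>\<^sub>1 \<omega>\<^sub>2 - e\<^sub>2 \<omega>\<^sub>1 \<omega>\<^sub>2) \<and>
             c = - \<i> * of_real (cmod c))"

definition karcher_p :: "complex \<Rightarrow> complex \<Rightarrow> complex \<Rightarrow> complex" where
  "karcher_p \<omega>\<^sub>1 \<omega>\<^sub>2 z =
     (weierstrass_p (period_lattice \<omega>\<^sub>1 \<omega>\<^sub>2) (z - \<omega>\<^sub>1 - \<omega>\<^sub>2) - e\<^sub>3 \<omega>\<^sub>1 \<omega>\<^sub>2) / karcher_const \<omega>\<^sub>1 \<omega>\<^sub>2"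

definition karcher_poles :: "complex \<Rightarrow> complex \<Rightarrow> complex set" where
  "karcher_poles \<omega>\<^sub>1 \<omega>\<^sub>2 = {\<omega>\<^sub>1 + \<omega>\<^sub>2 + l |l. l \<in> period_lattice \<omega>\<^sub>1 \<omega>\<^sub>2}"

definition paths_avoiding :: "complex set \<Rightarrow> complex \<Rightarrow> (real \<Rightarrow> complex) set" where
  "paths_avoiding P w =
     {g. valid_path g \<and> pathstart g = 0 \<and> pathfinish g = w \<and> path_image g \<inter> P = {}}"

text \<open>The descriptions in the next two definitions demand the same value along every path
  avoiding the poles. In particular the value of \<open>karcher_zeta\<close> at a pole is unspecified.\<close>

definition karcher_zeta :: "complex \<Rightarrow> complex \<Rightarrow> complex \<Rightarrow> complex" where
  "karcher_zeta \<omega>\<^sub>1 \<omega>\<^sub>2 z =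
     - (THE v. \<forall>g\<in>paths_avoiding (karcher_poles \<omega>\<^sub>1 \<omega>\<^sub>2) z.
                 (karcher_p \<omega>\<^sub>1 \<omega>\<^sub>2 has_contour_integral v) g)"

definition Z_fun :: "complex \<Rightarrow> complex \<Rightarrow> complex \<Rightarrow> ereal" where
  "Z_fun \<omega>\<^sub>1 \<omega>\<^sub>2 w =
     (if w \<in> karcher_poles \<omega>\<^sub>1 \<omega>\<^sub>2 then \<infinity>
      else ereal (- (1 / (2 * pi)) *
        (THE r. \<forall>g\<in>paths_avoiding (karcher_poles \<omega>\<^sub>1 \<omega>\<^sub>2) w.
           \<exists>v. ((\<lambda>z. karcher_const \<omega>\<^sub>1 \<omega>\<^sub>2 * karcher_zeta \<omega>\<^sub>1 \<omega>\<^sub>2 z) has_contour_integral v) g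
               \<and> r = Re v)))"

definition Z_hat :: "complex \<Rightarrow> complex \<Rightarrow> real \<Rightarrow> real \<Rightarrow> real \<Rightarrow> complex \<Rightarrow> ereal" where
  "Z_hat \<omega>\<^sub>1 \<omega>\<^sub>2 A B C z =
     Z_fun \<omega>\<^sub>1 \<omega>\<^sub>2 z + ereal (A * (Re z)\<^sup>2 + B * (Im z)\<^sup>2 + C * Re z * Im z)"

text \<open>The set of real numbers together with a single point \<open>\<infinity>\<close>, as a subset of the extended reals.\<close>

definition R_hat :: "ereal set" where
  "R_hat = range ereal \<union> {\<infinity>}"

text \<open>Real-analyticity in the two real variables \<open>Re z\<close> and \<open>Im z\<close>: local expansion into an
  (unconditionally convergent) double power series. It forces \<open>S\<close> to be open.\<close>

definition real_analytic_on :: "(complex \<Rightarrow> real) \<Rightarrow> complex set \<Rightarrow> bool" where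
  "real_analytic_on f S \<longleftrightarrow>
     (\<forall>p\<in>S. \<exists>r>0. \<exists>c :: nat \<Rightarrow> nat \<Rightarrow> real. ball p r \<subseteq> S \<and>
        (\<forall>z\<in>ball p r.
           ((\<lambda>(m, n). c m n * Re (z - p) ^ m * Im (z - p) ^ n) has_sum f z) UNIV))"

end

(* Up to an additive constant, the primitive of c * zeta is a logarithm of an entire function G built
   from the Weierstrass sigma-function, so Z is a multiple of ln |G| and hence harmonic off the poles.
   Since (G'/G)' is even and periodic, ln |G| is even and changes under a period 2h by
   Re (eta * (z + h)). A quadratic form produces the opposite increments exactly when the two linear
   functions satisfy one compatibility condition, and that condition is obtained by translating by
   both periods in either order. *)

theory Submission
  imports Defs
begin

text \<open>The obstacle is that \<open>karcher_zeta\<close> and \<open>Z_fun\<close> are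
  descriptions over all paths: each needs an explicit value that works for every path, and one
  existing path that makes this value unique. For zeta a primitive suffices, because the P-function
  has no residues. The primitive of c * zeta is multivalued: the integrand has residue 1 at every
  pole, so integrals along different paths differ by multiples of 2 pi i and only the real part
  survives. Working with G instead of its logarithm avoids a choice of branches. With s the sum of
  the two half periods, G(z) is sigma(z - s) / sigma(- s) times the exponential of a quadratic
  polynomial. The quadratic term accounts for the subtracted value e_3, the linear term makes G'(0)
  = 0, and the quotient makes G(0) = 1. Evenness of G rests on s being a half period: the P-function
  is even with period 2 s, so its translate by s is even too.\<close>

section \<open>Logarithmic derivatives\<close>

lemma deriv_logderiv_eq:
  fixes h :: "complex \<Rightarrow> complex"
  assumes "h holomorphic_on S" "open S" "z \<in> S" "h z \<noteq> 0"
  shows "deriv (\<lambda>w. deriv h w / h w) z = ((deriv ^^ 2) h z * h z - (deriv h z)\<^sup>2) / (h z)\<^sup>2"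
proof -
  have "(h has_field_derivative deriv h z) (at z)"
    using assms holomorphic_derivI by blast
  moreover have "(deriv h has_field_derivative deriv (deriv h) z) (at z)"
    using assms holomorphic_derivI holomorphic_deriv by blast
  ultimately show ?thesis
    using assms(4)
    by (intro DERIV_imp_deriv)
       (auto intro!: derivative_eq_intros simp: power2_eq_square numeral_2_eq_2)
qed

text \<open>Uniform convergence of holomorphic functions on an open set carries over to derivatives
  of every order, and the preceding formula expresses the quantity through the orders 0, 1 and 2 at
  the single point \<open>z\<close>.\<close>

lemma deriv_logderiv_uniform_limit:
  fixes F :: "nat \<Rightarrow> complex \<Rightarrow> complex"
  assumes lim: "uniform_limit S F g sequentially"
    and hol: "\<And>n. F n holomorphic_on S" "g holomorphic_on S"
    and S: "open S" "z \<in> S"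
    and nz: "\<And>n. F n z \<noteq> 0" "g z \<noteq> 0"
  shows "(\<lambda>n. deriv (\<lambda>w. deriv (F n) w / F n w) z) \<longlonglongrightarrow> deriv (\<lambda>w. deriv g w / g w) z"
proof -
  have "(\<lambda>n. (deriv ^^ m) (F n) z) \<longlonglongrightarrow> (deriv ^^ m) g z" for m
    using lim S hol by (intro higher_deriv_complex_uniform_limit[where A = S]) auto
  from this[of 0] this[of 1] this[of 2] show ?thesis
    using nz by (simp add: deriv_logderiv_eq[OF hol(1) S] deriv_logderiv_eq[OF hol(2) S])
                (intro tendsto_intros; simp)
qed

text \<open>The bracket is the logarithmic derivative of the factor (1 - u) exp(u + u^2 / 2) at u =
  w / c, which is also the general term of the Weierstrass zeta-function.\<close>

lemma weierstrass_factor_2_derivative: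
  assumes "c \<noteq> 0" "w \<noteq> c"
  shows "((\<lambda>w. weierstrass_factor 2 (w / c)) has_field_derivative
            weierstrass_factor 2 (w / c) * (1 / (w - c) + 1 / c + w / c\<^sup>2)) (at w)"
proof -
  have eq: "weierstrass_factor 2 z = (1 - z) * exp (z + z\<^sup>2 / 2)" for z
    by (simp add: weierstrass_factor_def numeral_2_eq_2)
  have "((\<lambda>w. (1 - w / c) * exp (w / c + (w / c)\<^sup>2 / 2)) has_field_derivative
          (- 1 / c + (1 - w / c) * (1 / c + w / c\<^sup>2)) * exp (w / c + (w / c)\<^sup>2 / 2)) (at w)"
    using assms
    by (auto intro!: derivative_eq_intros simp: power2_eq_square) (simp add: field_simps)
  moreover have "- 1 / c + (1 - w / c) * (1 / c + w / c\<^sup>2)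
                   = (1 - w / c) * (1 / (w - c) + 1 / c + w / c\<^sup>2)"
  proof -
    have "(1 - w / c) * (1 / (w - c)) = - 1 / c"
      using assms by (simp add: divide_simps)
    then show ?thesis by (simp add: distrib_left)
  qed
  ultimately show ?thesis
    by (simp add: eq mult_ac)
qed

section \<open>Lattices and the Weierstrass functions\<close>

text \<open>Discreteness follows from the summability of the inverse cubes, which also drives the
  convergence of the sigma product and of the P-series. Infinitude allows an enumeration by all
  natural numbers.\<close>

locale summable_lattice =
  fixes L :: "complex set"
  assumes zero_mem: "0 \<in> L"
    and add_mem: "\<And>k l. k \<in> L \<Longrightarrow> l \<in> L \<Longrightarrow> k + l \<in> L"
    and uminus_mem: "\<And>l. l \<in> L \<Longrightarrow> - l \<in> L"
    and infinite_lattice: "infinite L"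
    and summable_cube: "(\<lambda>l. 1 / norm l ^ 3) summable_on (L - {0})"
begin

lemma add_mem_iff: "l \<in> L \<Longrightarrow> z + l \<in> L \<longleftrightarrow> z \<in> L"
  by (metis add_mem uminus_mem add.assoc add.right_inverse add.right_neutral)

lemma uminus_mem_iff: "- z \<in> L \<longleftrightarrow> z \<in> L"
  using uminus_mem[of z] uminus_mem[of "- z"] by auto

lemma diff_mem: "k \<in> L \<Longrightarrow> l \<in> L \<Longrightarrow> k - l \<in> L"
  using add_mem[of k "- l"] uminus_mem by simp

text \<open>A summable family has only countably many nonzero terms, and the inverse cubes never
  vanish.\<close>

lemma countable_lattice: "countable L"
proof -
  have "countable {l \<in> L - {0}. 1 / norm l ^ 3 \<noteq> (0::real)}"
    by (rule abs_summable_countable) (use summable_cube in \<open>simp add: norm_divide norm_power\<close>)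
  also have "{l \<in> L - {0}. 1 / norm l ^ 3 \<noteq> (0::real)} = L - {0}"
    by auto
  finally show ?thesis
    by simp
qed

section \<open>Enumeration of the lattice and the sigma-function\<close>

definition enum :: "nat \<Rightarrow> complex" where
  "enum = from_nat_into (L - {0})"

lemma bij_betw_enum: "bij_betw enum UNIV (L - {0})"
  unfolding enum_def
  by (intro bij_betw_from_nat_into countable_Diff countable_lattice)
     (simp add: infinite_lattice)

lemma range_enum: "range enum = L - {0}"
  using bij_betw_enum by (simp add: bij_betw_def)

lemma enum_nonzero [simp]: "enum n \<noteq> 0" and enum_mem [simp]: "enum n \<in> L"
  using range_enum by auto

lemma summable_enum: "summable (\<lambda>n. 1 / norm (enum n) ^ 3)"
  using summable_cube summable_on_reindex_bij_betw[OF bij_betw_enum, of "\<lambda>l. 1 / norm l ^ 3"]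
  by (intro summable_on_imp_summable) simp

lemma filterlim_enum: "filterlim enum at_infinity sequentially"
proof -
  have "filterlim (\<lambda>n. inverse (1 / norm (enum n) ^ 3)) at_top sequentially"
    using summable_LIMSEQ_zero[OF summable_enum] by (rule filterlim_inverse_at_top) simp
  then have cube: "filterlim (\<lambda>n. norm (enum n) ^ 3) at_top sequentially"
    by simp
  have "filterlim (\<lambda>n. norm (enum n)) at_top sequentially"
    unfolding filterlim_at_top
  proof (rule allI)
    fix Z :: real
    have "eventually (\<lambda>n. norm (enum n) ^ 3 \<ge> (max Z 0) ^ 3) sequentially"
      using cube unfolding filterlim_at_top by blast
    then show "eventually (\<lambda>n. norm (enum n) \<ge> Z) sequentially"
      by eventually_elim (use power_mono_iff[of "max Z 0" _ 3] in auto)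
  qed
  then show ?thesis
    by (rule filterlim_norm_at_top_imp_at_infinity)
qed

text \<open>Genus 2 for every factor, because convergence then requires summability of the powers
  with exponent 2 + 1, the inverse cubes.\<close>

sublocale W: weierstrass_product enum "\<lambda>_. 2"
proof
  show "enum n \<noteq> 0" for n by simp
  show "filterlim enum at_infinity sequentially" by (rule filterlim_enum)
  show "summable (\<lambda>n. (r / norm (enum n)) ^ Suc 2)" if "r > 0" for r
    using summable_mult[OF summable_enum, of "r ^ 3"] by (simp add: power_divide eval_nat_numeral)
qed

lemma no_islimpt_lattice: "\<not> z islimpt L"
proof -
  have "L = insert 0 (range enum)"
    using range_enum zero_mem by auto
  then show ?thesis
    using W.not_islimpt_range_a by (metis islimpt_insert)
qed

lemma closed_lattice: "closed L"
  using no_islimpt_lattice closed_limpt by blast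

lemma finite_lattice_cball: "finite (L \<inter> cball 0 R)"
proof (rule ccontr)
  assume "infinite (L \<inter> cball 0 R)"
  then obtain z where "z islimpt (L \<inter> cball 0 R)"
    using Heine_Borel_imp_Bolzano_Weierstrass[OF compact_cball] by (metis Int_lower2)
  then show False
    using no_islimpt_lattice islimpt_subset by blast
qed

text \<open>The Weierstrass sigma-function; the factor \<open>z\<close> supplies the zero at the
  origin, which the enumeration omits.\<close>

definition sigma :: "complex \<Rightarrow> complex" where
  "sigma z = z * W.f z"

lemma sigma_holomorphic: "sigma holomorphic_on S"
  unfolding sigma_def by (intro holomorphic_intros W.holomorphic)

lemma sigma_eq_0_iff: "sigma z = 0 \<longleftrightarrow> z \<in> L"
  using W.zero[of z] range_enum zero_mem by (auto simp: sigma_def)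

section \<open>Absolute convergence of the P-series\<close>

text \<open>Over a common denominator the difference is z (2 l - z) / (l^2 (z - l)^2). Estimating |2
  l - z| by 5/2 |l| and |z - l| from below by |l| / 2 gives the constant 5/2 * 4 = 10.\<close>

lemma weierstrass_term_bound:
  fixes l z :: complex
  assumes "l \<noteq> 0" "2 * norm z \<le> norm l"
  shows "norm (1 / (z - l)\<^sup>2 - 1 / l\<^sup>2) \<le> 10 * norm z / norm l ^ 3"
proof (cases "z = 0")
  case False
  have half: "norm l / 2 \<le> norm (z - l)"
    using norm_triangle_ineq2[of l z] assms by (simp add: norm_minus_commute)
  have pos: "norm l > 0" "z - l \<noteq> 0"
    using assms half by auto
  have "1 / (z - l)\<^sup>2 - 1 / l\<^sup>2 = z * (2 * l - z) / (l\<^sup>2 * (z - l)\<^sup>2)"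
    using assms pos by (simp add: diff_frac_eq) (simp add: power2_eq_square algebra_simps)
  also have "norm \<dots> = norm z * norm (2 * l - z) / ((norm l)\<^sup>2 * (norm (z - l))\<^sup>2)"
    by (simp add: norm_mult norm_divide norm_power)
  also have "\<dots> \<le> norm z * (5 / 2 * norm l) / ((norm l)\<^sup>2 * (norm l / 2)\<^sup>2)"
  proof (intro frac_le mult_left_mono power_mono half)
    have "norm (2 * l - z) \<le> 2 * norm l + norm z"
      using norm_triangle_ineq4[of "2 * l" z] by (simp add: norm_mult)
    then show "norm (2 * l - z) \<le> 5 / 2 * norm l"
      using assms by simp
  qed (use pos in auto)
  also have "\<dots> = 10 * norm z / norm l ^ 3"
    using pos by (simp add: field_simps eval_nat_numeral)
  finally show ?thesis .
qed simp

lemma weierstrass_abs_summable: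
  "(\<lambda>l. norm (1 / (z - l)\<^sup>2 - 1 / l\<^sup>2)) summable_on (L - {0})"
proof -
  define K where "K = L \<inter> cball 0 (2 * norm z)"
  have "(\<lambda>l. 10 * norm z * (1 / norm l ^ 3)) summable_on (L - {0})"
    by (intro summable_on_cmult_right summable_cube)
  then have "(\<lambda>l. 10 * norm z * (1 / norm l ^ 3)) summable_on (L - {0} - K)"
    by (rule summable_on_subset) auto
  then have "(\<lambda>l. norm (1 / (z - l)\<^sup>2 - 1 / l\<^sup>2)) summable_on (L - {0} - K)"
    by (rule summable_on_comparison_test)
       (use weierstrass_term_bound[of _ z] in \<open>auto simp: K_def\<close>)
  moreover have "(\<lambda>l. norm (1 / (z - l)\<^sup>2 - 1 / l\<^sup>2)) summable_on (K - {0})"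
    using finite_lattice_cball[of "2 * norm z"] by (intro summable_on_finite) (auto simp: K_def)
  ultimately have "(\<lambda>l. norm (1 / (z - l)\<^sup>2 - 1 / l\<^sup>2)) summable_on ((L - {0} - K) \<union> (K - {0}))"
    by (rule summable_on_union)
  also have "(L - {0} - K) \<union> (K - {0}) = L - {0}"
    by (auto simp: K_def)
  finally show ?thesis .
qed

lemma weierstrass_sums:
  "(\<lambda>n. 1 / (z - enum n)\<^sup>2 - 1 / (enum n)\<^sup>2) sums (weierstrass_p L z - 1 / z\<^sup>2)"
proof -
  have "((\<lambda>l. 1 / (z - l)\<^sup>2 - 1 / l\<^sup>2) has_sum (weierstrass_p L z - 1 / z\<^sup>2)) (L - {0})"
    unfolding weierstrass_p_def
    using Infinite_Sum.abs_summable_summable[OF weierstrass_abs_summable[of z]] by simp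
  then show ?thesis
    using has_sum_reindex_bij_betw[OF bij_betw_enum, of "\<lambda>l. 1 / (z - l)\<^sup>2 - 1 / l\<^sup>2"]
    by (intro has_sum_imp_sums) simp
qed

section \<open>The second logarithmic derivative of the sigma-function\<close>

text \<open>Finite products have finite sums as logarithmic derivatives, so both differentiations
  can be done termwise before the limit is taken.\<close>

definition sigma_part :: "nat \<Rightarrow> complex \<Rightarrow> complex" where
  "sigma_part N z = z * (\<Prod>n<N. weierstrass_factor 2 (z / enum n))"

lemma sigma_part_holomorphic: "sigma_part N holomorphic_on S"
  unfolding sigma_part_def by (intro holomorphic_intros) auto

lemma sigma_part_nonzero: "z \<notin> L \<Longrightarrow> sigma_part N z \<noteq> 0"
proof -
  assume z: "z \<notin> L"
  then have "z \<noteq> enum n" "z \<noteq> 0" for n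
    using enum_mem zero_mem by metis+
  then show ?thesis
    by (auto simp: sigma_part_def)
qed

text \<open>The extra factor \<open>z\<close> preserves uniform convergence because both it and the
  limit product are bounded on the disc.\<close>

lemma uniform_limit_sigma_part:
  assumes "R > 0"
  shows "uniform_limit (cball 0 R) sigma_part sigma sequentially"
proof -
  have "uniform_limit (cball 0 R) (\<lambda>N z. z * (\<Prod>n<N. weierstrass_factor 2 (z / enum n)))
          (\<lambda>z. z * W.f z) sequentially"
  proof (rule uniform_lim_mult[OF uniform_limit_const W.uniform_limit[OF assms]])
    show "bounded ((\<lambda>z. z) ` cball (0::complex) R)"
      by simp
    have "compact (W.f ` cball 0 R)"
      by (intro compact_continuous_image holomorphic_on_imp_continuous_on W.holomorphic compact_cball)
    then show "bounded (W.f ` cball 0 R)"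
      by (rule compact_imp_bounded)
  qed
  then show ?thesis
    by (simp add: sigma_part_def[abs_def] sigma_def[abs_def])
qed

lemma sigma_part_logderiv:
  assumes "w \<notin> L"
  shows "deriv (sigma_part N) w / sigma_part N w =
           1 / w + (\<Sum>n<N. 1 / (w - enum n) + 1 / enum n + w / (enum n)\<^sup>2)"
proof -
  have nz: "w \<noteq> enum n" "w \<noteq> 0" for n
    using assms enum_mem zero_mem by metis+
  have "(sigma_part N has_field_derivative
          sigma_part N w * (1 / w + (\<Sum>n<N. 1 / (w - enum n) + 1 / enum n + w / (enum n)\<^sup>2))) (at w)"
  proof (induction N)
    case 0
    have "sigma_part 0 = (\<lambda>w. w)"
      by (simp add: sigma_part_def fun_eq_iff)
    then show ?case
      using nz by simp
  next
    case (Suc N)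
    have eq: "sigma_part (Suc N) = (\<lambda>w. sigma_part N w * weierstrass_factor 2 (w / enum N))"
      by (simp add: sigma_part_def fun_eq_iff)
    show ?case
      unfolding eq
      by (rule DERIV_cong[OF DERIV_mult[OF Suc.IH weierstrass_factor_2_derivative]])
         (use nz in \<open>simp_all add: algebra_simps\<close>)
  qed
  then show ?thesis
    using sigma_part_nonzero[OF assms, of N] by (simp add: DERIV_imp_deriv)
qed

lemma sigma_part_deriv_logderiv:
  assumes "z \<notin> L"
  shows "deriv (\<lambda>w. deriv (sigma_part N) w / sigma_part N w) z =
           - 1 / z\<^sup>2 - (\<Sum>n<N. 1 / (z - enum n)\<^sup>2 - 1 / (enum n)\<^sup>2)"
proof -
  have nz: "z \<noteq> enum n" "z \<noteq> 0" for n
    using assms enum_mem zero_mem by metis+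
  have "((\<lambda>w. 1 / w + (\<Sum>n<N. 1 / (w - enum n) + 1 / enum n + w / (enum n)\<^sup>2))
          has_field_derivative - 1 / z\<^sup>2 + (\<Sum>n<N. - 1 / (z - enum n)\<^sup>2 + 1 / (enum n)\<^sup>2)) (at z)"
  proof (rule DERIV_add; (rule DERIV_sum)?)
    show "((\<lambda>w. 1 / w) has_field_derivative - 1 / z\<^sup>2) (at z)"
      using nz by (auto intro!: derivative_eq_intros simp: power2_eq_square)
    show "((\<lambda>w. 1 / (w - enum n) + 1 / enum n + w / (enum n)\<^sup>2) has_field_derivative
            - 1 / (z - enum n)\<^sup>2 + 1 / (enum n)\<^sup>2) (at z)" for n
      using nz(1)[of n] by (auto intro!: derivative_eq_intros simp: power2_eq_square)
  qed
  moreover have "- 1 / z\<^sup>2 + (\<Sum>n<N. - 1 / (z - enum n)\<^sup>2 + 1 / (enum n)\<^sup>2)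
                   = - 1 / z\<^sup>2 - (\<Sum>n<N. 1 / (z - enum n)\<^sup>2 - 1 / (enum n)\<^sup>2)"
    by (simp add: sum_subtractf sum.distrib sum_negf)
  ultimately have "((\<lambda>w. 1 / w + (\<Sum>n<N. 1 / (w - enum n) + 1 / enum n + w / (enum n)\<^sup>2))
      has_field_derivative - 1 / z\<^sup>2 - (\<Sum>n<N. 1 / (z - enum n)\<^sup>2 - 1 / (enum n)\<^sup>2)) (at z)"
    by (simp only:)
  then have "((\<lambda>w. deriv (sigma_part N) w / sigma_part N w) has_field_derivative
      - 1 / z\<^sup>2 - (\<Sum>n<N. 1 / (z - enum n)\<^sup>2 - 1 / (enum n)\<^sup>2)) (at z)"
    by (rule has_field_derivative_transform_within_open[where S = "- L"])
       (use assms closed_lattice in \<open>simp_all add: sigma_part_logderiv open_Compl\<close>)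
  then show ?thesis
    by (rule DERIV_imp_deriv)
qed

text \<open>Both sides are limits of the identity for \<open>sigma_part\<close>: the left by uniform
  convergence of the products, the right by the series of the P-function. This fixes the value of
  the derivative; its existence comes from holomorphy off the lattice.\<close>

lemma sigma_logderiv_derivative:
  assumes "z \<notin> L"
  shows "((\<lambda>w. deriv sigma w / sigma w) has_field_derivative - weierstrass_p L z) (at z)"
proof -
  have "uniform_limit (ball 0 (norm z + 1)) sigma_part sigma sequentially"
    by (rule uniform_limit_on_subset[OF uniform_limit_sigma_part[of "norm z + 1"]])
       (auto intro: add_nonneg_pos)
  then have "(\<lambda>N. deriv (\<lambda>w. deriv (sigma_part N) w / sigma_part N w) z)
               \<longlonglongrightarrow> deriv (\<lambda>w. deriv sigma w / sigma w) z"
    by (rule deriv_logderiv_uniform_limit)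
       (use assms in \<open>simp_all add: sigma_part_holomorphic sigma_holomorphic sigma_part_nonzero
          sigma_eq_0_iff\<close>)
  moreover have "(\<lambda>N. deriv (\<lambda>w. deriv (sigma_part N) w / sigma_part N w) z)
                   \<longlonglongrightarrow> - 1 / z\<^sup>2 - (weierstrass_p L z - 1 / z\<^sup>2)"
    unfolding sigma_part_deriv_logderiv[OF assms]
    by (intro tendsto_intros weierstrass_sums[unfolded sums_def])
  ultimately have "deriv (\<lambda>w. deriv sigma w / sigma w) z = - weierstrass_p L z"
    using LIMSEQ_unique by fastforce
  moreover have "(\<lambda>w. deriv sigma w / sigma w) holomorphic_on - L"
    by (intro holomorphic_intros holomorphic_deriv sigma_holomorphic)
       (use closed_lattice in \<open>auto simp: sigma_eq_0_iff\<close>)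
  ultimately show ?thesis
    using assms closed_lattice holomorphic_derivI[of _ "- L" z] by fastforce
qed

section \<open>Evenness and periodicity of the P-function\<close>

lemma weierstrass_p_uminus: "weierstrass_p L (- z) = weierstrass_p L z"
proof -
  have "(\<Sum>\<^sub>\<infinity>l\<in>L - {0}. 1 / (- z - l)\<^sup>2 - 1 / l\<^sup>2) = (\<Sum>\<^sub>\<infinity>l\<in>L - {0}. 1 / (z - l)\<^sup>2 - 1 / l\<^sup>2)"
  proof (rule infsum_reindex_bij_witness[of _ uminus uminus])
    fix l
    show "1 / (z - - l)\<^sup>2 - 1 / (- l)\<^sup>2 = 1 / (- z - l)\<^sup>2 - 1 / l\<^sup>2"
      by (simp add: power2_eq_square algebra_simps)
  qed (auto intro: uminus_mem)
  then show ?thesis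
    by (simp add: weierstrass_p_def)
qed

text \<open>Summing over all of \<open>L\<close>, with \<open>1 / 0 = 0\<close> at the origin, turns a translation
  of \<open>z\<close> into a reindexing.\<close>

lemma weierstrass_has_sum:
  "((\<lambda>l. 1 / (z - l)\<^sup>2 - 1 / l\<^sup>2) has_sum weierstrass_p L z) L"
proof -
  have "((\<lambda>l. 1 / (z - l)\<^sup>2 - 1 / l\<^sup>2) has_sum (weierstrass_p L z - 1 / z\<^sup>2)) (L - {0})"
    unfolding weierstrass_p_def
    using Infinite_Sum.abs_summable_summable[OF weierstrass_abs_summable[of z]] by simp
  from has_sum_insert[OF _ this, of 0] zero_mem show ?thesis
    by (simp add: insert_absorb)
qed

text \<open>Reindexing by \<open>k\<close> turns the series at \<open>z + k\<close> into one with
  the same terms 1 / (z - l)^2 as the series at \<open>z\<close>. They cancel in the difference, and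
  what remains no longer contains \<open>z\<close>.\<close>

lemma weierstrass_p_add_lattice:
  assumes "k \<in> L"
  obtains C where "\<And>z. weierstrass_p L (z + k) = weierstrass_p L z + C"
proof -
  have "weierstrass_p L (z + k) - weierstrass_p L z = (\<Sum>\<^sub>\<infinity>l\<in>L. 1 / l\<^sup>2 - 1 / (l + k)\<^sup>2)" for z
  proof -
    have "((\<lambda>l. 1 / (z - l)\<^sup>2 - 1 / (l + k)\<^sup>2) has_sum weierstrass_p L (z + k)) L \<longleftrightarrow>
          ((\<lambda>l. 1 / (z + k - l)\<^sup>2 - 1 / l\<^sup>2) has_sum weierstrass_p L (z + k)) L"
      by (rule has_sum_reindex_bij_witness[of _ "\<lambda>l. l - k" "\<lambda>l. l + k"])
         (use assms in \<open>auto intro: add_mem diff_mem simp: algebra_simps\<close>)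
    then have "((\<lambda>l. 1 / (z - l)\<^sup>2 - 1 / (l + k)\<^sup>2) has_sum weierstrass_p L (z + k)) L"
      using weierstrass_has_sum by blast
    from has_sum_add[OF this has_sum_uminusI[OF weierstrass_has_sum[of z]]] show ?thesis
      by (simp add: infsumI)
  qed
  then show ?thesis
    by (intro that) (simp add: algebra_simps)
qed

text \<open>At \<open>z = - h\<close> evenness determines the constant of the previous lemma.\<close>

lemma weierstrass_p_periodic:
  assumes "2 * h \<in> L"
  shows "weierstrass_p L (z + 2 * h) = weierstrass_p L z"
proof -
  obtain C where C: "\<And>z. weierstrass_p L (z + 2 * h) = weierstrass_p L z + C"
    using weierstrass_p_add_lattice[OF assms] by blast
  from C[of "- h"] have "C = 0"
    using weierstrass_p_uminus[of h] by simp
  with C show ?thesis by simp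
qed

end

section \<open>Normalised sigma-function\<close>

lemma DERIV_mirror_complex:
  fixes f :: "complex \<Rightarrow> complex"
  assumes "(f has_field_derivative D) (at (- z))"
  shows "((\<lambda>z. f (- z)) has_field_derivative - D) (at z)"
  using DERIV_chain2[where f = f and g = uminus and x = z and s = UNIV, OF assms DERIV_minus[OF DERIV_ident]]
  by simp

context summable_lattice
begin

definition poles :: "complex \<Rightarrow> complex set" where
  "poles s = {z. z - s \<in> L}"

lemma open_Compl_poles: "open (- poles s)"
proof -
  have "poles s = (\<lambda>z. z - s) -` L"
    by (auto simp: poles_def)
  then show ?thesis
    by (simp add: open_Compl continuous_closed_vimage closed_lattice)
qed

lemma connected_Compl_poles: "connected (- poles s)"
proof -
  have "poles s = (\<lambda>l. l + s) ` L"
    by (force simp: poles_def image_iff)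
  then have "countable (poles s)"
    using countable_lattice by simp
  then show ?thesis
    by (intro path_connected_imp_connected path_connected_complement_countable) simp
qed

lemma add_mem_poles_iff: "l \<in> L \<Longrightarrow> z + l \<in> poles s \<longleftrightarrow> z \<in> poles s"
  using add_mem_iff[of l "z - s"] by (simp add: poles_def algebra_simps)

lemma uminus_mem_poles_iff:
  assumes "2 * s \<in> L"
  shows "- z \<in> poles s \<longleftrightarrow> z \<in> poles s"
  using add_mem_iff[OF assms, of "- z - s"] uminus_mem_iff[of "z - s"] by (simp add: poles_def)

lemma zero_notin_poles: "s \<notin> L \<Longrightarrow> 0 \<notin> poles s"
  using uminus_mem_iff[of s] by (simp add: poles_def)

text \<open>The source of the functional equations for \<open>kzeta\<close> and
  \<open>ksigma\<close>: a suitable sum, difference or quotient has derivative 0 and is constant on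
  the connected complement of the poles. For the parity statements the constant is read off at
  0.\<close>

lemma constant_off_poles:
  assumes "\<And>z. z \<notin> poles s \<Longrightarrow> (f has_field_derivative 0) (at z)"
  shows "\<exists>c. \<forall>z. z \<notin> poles s \<longrightarrow> f z = (c :: complex)"
proof -
  have "f constant_on (- poles s)"
    by (rule has_field_derivative_0_imp_constant_on)
       (auto simp: assms connected_Compl_poles open_Compl_poles)
  then show ?thesis
    by (auto simp: constant_on_def)
qed

text \<open>Integrating \<open>e - weierstrass_p L (z - s)\<close> twice from \<open>0\<close> gives \<open>kzeta\<close> and a logarithm of
  \<open>ksigma\<close>.\<close>

definition kzeta :: "complex \<Rightarrow> complex \<Rightarrow> complex \<Rightarrow> complex" where
  "kzeta s e z = deriv sigma (z - s) / sigma (z - s) + e * z - deriv sigma (- s) / sigma (- s)"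

definition ksigma :: "complex \<Rightarrow> complex \<Rightarrow> complex \<Rightarrow> complex" where
  "ksigma s e z =
     sigma (z - s) / sigma (- s) * exp (e * z\<^sup>2 / 2 - deriv sigma (- s) / sigma (- s) * z)"

lemma kzeta_0 [simp]: "kzeta s e 0 = 0"
  by (simp add: kzeta_def)

lemma kzeta_derivative:
  assumes "z \<notin> poles s"
  shows "(kzeta s e has_field_derivative - (weierstrass_p L (z - s) - e)) (at z)"
proof -
  have "((\<lambda>z. deriv sigma (z - s) / sigma (z - s)) has_field_derivative - weierstrass_p L (z - s)) (at z)"
    using sigma_logderiv_derivative[of "z - s"] assms
      DERIV_shift[of "\<lambda>w. deriv sigma w / sigma w" _ z "- s"]
    by (simp add: poles_def)
  then show ?thesis
    unfolding kzeta_def[abs_def]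
    by (rule DERIV_cong[OF DERIV_diff[OF DERIV_add[OF _ DERIV_cmult[OF DERIV_ident]] DERIV_const]]) simp
qed

lemma ksigma_derivative:
  assumes "z \<notin> poles s"
  shows "(ksigma s e has_field_derivative ksigma s e z * kzeta s e z) (at z)"
proof -
  have "(sigma has_field_derivative deriv sigma (z - s)) (at (z - s))"
    using sigma_holomorphic[of UNIV] holomorphic_derivI by blast
  then have shift: "((\<lambda>z. sigma (z - s)) has_field_derivative deriv sigma (z - s)) (at z)"
    using DERIV_shift[of sigma _ z "- s"] by simp
  have nz: "sigma (z - s) \<noteq> 0"
    using assms by (simp add: sigma_eq_0_iff poles_def)
  define k where "k = deriv sigma (- s) / sigma (- s)"
  have "((\<lambda>z. sigma (z - s) / sigma (- s)) has_field_derivative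
          sigma (z - s) / sigma (- s) * (deriv sigma (z - s) / sigma (z - s))) (at z)"
    by (rule DERIV_cong[OF DERIV_cdivide[OF shift]]) (use nz in simp)
  moreover have "((\<lambda>z. exp (e * z\<^sup>2 / 2 - k * z)) has_field_derivative
      exp (e * z\<^sup>2 / 2 - k * z) * (e * z - k)) (at z)"
    by (auto intro!: derivative_eq_intros)
  ultimately show ?thesis
    unfolding ksigma_def[abs_def] kzeta_def k_def[symmetric]
    by (rule DERIV_cong[OF DERIV_mult])
       (simp add: algebra_simps add_divide_distrib diff_divide_distrib)
qed

lemma ksigma_holomorphic: "ksigma s e holomorphic_on - poles s"
  using ksigma_derivative open_Compl_poles by (auto simp: holomorphic_on_open)

lemma ksigma_0 [simp]: "s \<notin> L \<Longrightarrow> ksigma s e 0 = 1"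
  using uminus_mem_iff[of s] by (simp add: ksigma_def sigma_eq_0_iff)

lemma ksigma_nonzero: "s \<notin> L \<Longrightarrow> z \<notin> poles s \<Longrightarrow> ksigma s e z \<noteq> 0"
  using uminus_mem_iff[of s] by (simp add: ksigma_def sigma_eq_0_iff poles_def)

text \<open>Evenness and the period 2 s give P(- z - s) = P(- z + s) = P(z - s), so the derivative
  of \<open>kzeta\<close> is even. Since \<open>kzeta\<close> vanishes at 0, it is odd.\<close>

lemma kzeta_uminus:
  assumes s: "s \<notin> L" "2 * s \<in> L" and z: "z \<notin> poles s"
  shows "kzeta s e (- z) = - kzeta s e z"
proof -
  have "((\<lambda>z. kzeta s e z + kzeta s e (- z)) has_field_derivative 0) (at z)"
    if z: "z \<notin> poles s" for z
  proof -
    have "weierstrass_p L (- z - s) = weierstrass_p L (z - s)"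
      using weierstrass_p_periodic[OF s(2), of "- z - s"] weierstrass_p_uminus[of "z - s"]
      by (simp add: algebra_simps)
    moreover have "- z \<notin> poles s"
      using z s uminus_mem_poles_iff by blast
    ultimately show ?thesis
      using DERIV_add[OF kzeta_derivative[OF z, of e] DERIV_mirror_complex[OF kzeta_derivative[of "- z" s e]]]
      by simp
  qed
  then have "\<exists>c. \<forall>z. z \<notin> poles s \<longrightarrow> kzeta s e z + kzeta s e (- z) = c"
    by (rule constant_off_poles)
  then obtain c where c: "\<And>z. z \<notin> poles s \<Longrightarrow> kzeta s e z + kzeta s e (- z) = c"
    by blast
  from c[OF zero_notin_poles[OF s(1)]] have "c = 0"
    by simp
  with c[OF z] show ?thesis
    by (simp add: add_eq_0_iff)
qed

text \<open>The oddness of the logarithmic derivative \<open>kzeta\<close> makes the quotient of the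
  two sides constant, with value 1 at 0.\<close>

lemma ksigma_uminus:
  assumes s: "s \<notin> L" "2 * s \<in> L" and z: "z \<notin> poles s"
  shows "ksigma s e (- z) = ksigma s e z"
proof -
  have "((\<lambda>z. ksigma s e (- z) / ksigma s e z) has_field_derivative 0) (at z)"
    if z: "z \<notin> poles s" for z
  proof -
    have "- z \<notin> poles s"
      using z s uminus_mem_poles_iff by blast
    from DERIV_mirror_complex[OF ksigma_derivative[OF this, of e]]
    have "((\<lambda>z. ksigma s e (- z)) has_field_derivative ksigma s e (- z) * kzeta s e z) (at z)"
      using kzeta_uminus[OF s z] by simp
    from DERIV_divide[OF this ksigma_derivative[OF z, of e] ksigma_nonzero[OF s(1) z]] show ?thesis
      by (simp add: mult_ac)
  qed
  then have "\<exists>c. \<forall>z. z \<notin> poles s \<longrightarrow> ksigma s e (- z) / ksigma s e z = c"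
    by (rule constant_off_poles)
  then obtain c where c: "\<And>z. z \<notin> poles s \<Longrightarrow> ksigma s e (- z) / ksigma s e z = c"
    by blast
  from c[OF zero_notin_poles[OF s(1)]] have "c = 1"
    using s by simp
  with c[OF z] show ?thesis
    using ksigma_nonzero[OF s(1) z] by simp
qed

text \<open>The increment \<open>\<eta>\<close> is the quasi-period of the Weierstrass zeta-function
  for 2 h, plus 2 h e from the linear term.\<close>

lemma kzeta_add_period:
  assumes "2 * h \<in> L"
  obtains \<eta> where "\<And>z. z \<notin> poles s \<Longrightarrow> kzeta s e (z + 2 * h) = kzeta s e z + \<eta>"
proof -
  have "((\<lambda>z. kzeta s e (z + 2 * h) - kzeta s e z) has_field_derivative 0) (at z)"
    if z: "z \<notin> poles s" for z
  proof -
    have "weierstrass_p L (z + 2 * h - s) = weierstrass_p L (z - s)"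
      using weierstrass_p_periodic[OF assms, of "z - s"] by (simp add: algebra_simps)
    moreover have "z + 2 * h \<notin> poles s"
      using z assms add_mem_poles_iff by blast
    ultimately show ?thesis
      using DERIV_diff[OF kzeta_derivative[of "z + 2 * h" s e, THEN DERIV_shift[THEN iffD1]]
                         kzeta_derivative[OF z, of e]]
      by simp
  qed
  then have "\<exists>c. \<forall>z. z \<notin> poles s \<longrightarrow> kzeta s e (z + 2 * h) - kzeta s e z = c"
    by (rule constant_off_poles)
  then obtain c where c: "\<And>z. z \<notin> poles s \<Longrightarrow> kzeta s e (z + 2 * h) - kzeta s e z = c"
    by blast
  then show ?thesis
    by (intro that[of c]) (simp add: algebra_simps eq_diff_eq[symmetric])
qed

text \<open>Evenness fixes the additive constant, by evaluating at \<open>- h\<close>.\<close>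

lemma ln_ksigma_add_period:
  assumes s: "s \<notin> L" "2 * s \<in> L" and h: "2 * h \<in> L" "h \<notin> poles s"
  obtains \<eta> where "\<And>z. z \<notin> poles s \<Longrightarrow>
    ln (norm (ksigma s e (z + 2 * h))) = ln (norm (ksigma s e z)) + Re (\<eta> * (z + h))"
proof -
  obtain \<eta> where \<eta>: "\<And>z. z \<notin> poles s \<Longrightarrow> kzeta s e (z + 2 * h) = kzeta s e z + \<eta>"
    using kzeta_add_period[OF h(1)] by blast
  \<comment> \<open>The exponential absorbs the increment of \<open>kzeta\<close>: numerator and
    denominator have the same logarithmic derivative \<open>kzeta s e z + \<eta>\<close>.\<close>
  have "((\<lambda>z. ksigma s e (z + 2 * h) / (ksigma s e z * exp (\<eta> * z))) has_field_derivative 0) (at z)"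
    if z: "z \<notin> poles s" for z
  proof -
    have "z + 2 * h \<notin> poles s"
      using z h add_mem_poles_iff by blast
    from ksigma_derivative[OF this, of e, THEN DERIV_shift[THEN iffD1]]
    have 1: "((\<lambda>z. ksigma s e (z + 2 * h)) has_field_derivative
            ksigma s e (z + 2 * h) * (kzeta s e z + \<eta>)) (at z)"
      using \<eta>[OF z] by simp
    have 2: "((\<lambda>z. ksigma s e z * exp (\<eta> * z)) has_field_derivative
            ksigma s e z * exp (\<eta> * z) * (kzeta s e z + \<eta>)) (at z)"
      using z by (auto intro!: derivative_eq_intros ksigma_derivative simp: algebra_simps)
    show ?thesis
      using DERIV_divide[OF 1 2] ksigma_nonzero[OF s(1) z] by (simp add: mult_ac)
  qed
  then have "\<exists>c. \<forall>z. z \<notin> poles s \<longrightarrow>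
      ksigma s e (z + 2 * h) / (ksigma s e z * exp (\<eta> * z)) = c"
    by (rule constant_off_poles)
  then obtain c where c: "\<And>z. z \<notin> poles s \<Longrightarrow>
      ksigma s e (z + 2 * h) / (ksigma s e z * exp (\<eta> * z)) = c"
    by blast
  have eq: "ln (norm (ksigma s e (z + 2 * h))) = ln (norm c) + ln (norm (ksigma s e z)) + Re (\<eta> * z)"
    if z: "z \<notin> poles s" for z
  proof -
    have "z + 2 * h \<notin> poles s"
      using z h add_mem_poles_iff by blast
    then have nz: "ksigma s e (z + 2 * h) \<noteq> 0" "ksigma s e z \<noteq> 0"
      using z s ksigma_nonzero by auto
    then have "c \<noteq> 0"
      using c[OF z] by auto
    have "ksigma s e (z + 2 * h) = c * ksigma s e z * exp (\<eta> * z)"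
      using c[OF z] nz by (auto simp: field_simps)
    then show ?thesis
      using nz \<open>c \<noteq> 0\<close> by (simp add: norm_mult ln_mult)
  qed
  have "- h \<notin> poles s"
    using h s uminus_mem_poles_iff by blast
  from eq[OF this] have "ln (norm c) = Re (\<eta> * h)"
    using ksigma_uminus[OF s h(2)] by simp
  with eq show ?thesis
    by (intro that[of \<eta>]) (simp add: algebra_simps)
qed

end

section \<open>Integration along paths avoiding the poles\<close>

lemma has_contour_integral_paths_avoiding:
  assumes "\<And>z. z \<notin> P \<Longrightarrow> (f has_field_derivative f' z) (at z)" "g \<in> paths_avoiding P w"
  shows "(f' has_contour_integral f w - f 0) g"
proof -
  have "(f' has_contour_integral f (pathfinish g) - f (pathstart g)) g"
    by (rule contour_integral_primitive[where S = "- P"])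
       (use assms in \<open>auto simp: paths_avoiding_def intro: DERIV_subset\<close>)
  then show ?thesis
    using assms(2) by (simp add: paths_avoiding_def)
qed

text \<open>Needed for uniqueness: if no path existed, a condition quantified over all paths would
  hold for every value and the descriptions would be undetermined.\<close>

lemma paths_avoiding_nonempty:
  assumes "open (- P)" "connected (- P)" "0 \<notin> P" "w \<notin> P"
  shows "paths_avoiding P w \<noteq> {}"
proof -
  obtain g where "polynomial_function g" "path_image g \<subseteq> - P" "pathstart g = 0" "pathfinish g = w"
    using connected_open_polynomial_connected[OF assms(1,2), of 0 w] assms(3,4) by auto
  then show ?thesis
    by (auto simp: paths_avoiding_def intro!: valid_path_polynomial_function)
qed

text \<open>Along a path, a logarithmic derivative integrates to a logarithm of the quotient of the
  end values; only its imaginary part depends on the path.\<close>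

lemma Re_contour_integral_logderiv:
  assumes hol: "f holomorphic_on S" and S: "open S" and nz: "\<And>z. z \<in> S \<Longrightarrow> f z \<noteq> 0"
    and g: "valid_path g" "path_image g \<subseteq> S"
  obtains v where "((\<lambda>z. deriv f z / f z) has_contour_integral v) g"
    "Re v = ln (norm (f (pathfinish g))) - ln (norm (f (pathstart g)))"
proof -
  have "(\<lambda>z. deriv f z / f z) holomorphic_on S"
    using hol S nz by (intro holomorphic_intros holomorphic_deriv)
  then have "(\<lambda>z. deriv f z / f z) contour_integrable_on g"
    using contour_integrable_holomorphic_simple S g by blast
  then have v: "((\<lambda>z. deriv f z / f z) has_contour_integral contour_integral g (\<lambda>z. deriv f z / f z)) g"
    by (rule has_contour_integral_integral)
  have an: "f analytic_on S"
    using hol S analytic_on_open by blast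
  have vp: "valid_path (f \<circ> g)"
    using valid_path_compose_analytic[OF g(1) an g(2)] .
  have "0 \<notin> (f \<circ> g) ` {0..1}"
    using g(2) nz by (force simp: path_image_def)
  \<comment> \<open>The exponential formula behind winding numbers, for the image path about 0. It
    holds for paths that are not closed, so no logarithm of \<open>f\<close> along \<open>g\<close>
    has to be constructed.\<close>
  then have "exp (- integral {0..1} (\<lambda>x. vector_derivative (f \<circ> g) (at x) / ((f \<circ> g) x - 0)))
               * ((f \<circ> g) 1 - 0) = (f \<circ> g) 0 - 0"
    using vp by (intro winding_number_exp_integral(2)) (auto simp: valid_path_def)
  also have "integral {0..1} (\<lambda>x. vector_derivative (f \<circ> g) (at x) / ((f \<circ> g) x - 0))
               = contour_integral (f \<circ> g) (\<lambda>z. 1 / z)"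
    by (simp add: contour_integral_integral)
  also have "\<dots> = contour_integral g (\<lambda>z. deriv f z / f z)"
    by (simp add: contour_integral_comp_analyticW[OF an g])
  finally have "exp (- contour_integral g (\<lambda>z. deriv f z / f z)) * f (pathfinish g) = f (pathstart g)"
    by (simp add: pathstart_def pathfinish_def)
  then have "norm (f (pathstart g)) =
      exp (- Re (contour_integral g (\<lambda>z. deriv f z / f z))) * norm (f (pathfinish g))"
    by (metis norm_mult norm_exp_eq_Re uminus_complex.sel(1))
  moreover have "f (pathfinish g) \<noteq> 0"
    using g nz by (meson pathfinish_in_path_image subsetD)
  ultimately have "Re (contour_integral g (\<lambda>z. deriv f z / f z)) =
      ln (norm (f (pathfinish g))) - ln (norm (f (pathstart g)))"
    by (simp add: ln_mult)
  with v show ?thesis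
    by (rule that)
qed

section \<open>Real-analytic functions\<close>

lemma real_analytic_on_cong:
  assumes "real_analytic_on f S" and eq: "\<And>z. z \<in> S \<Longrightarrow> g z = f z"
  shows "real_analytic_on g S"
  unfolding real_analytic_on_def
proof
  fix p assume "p \<in> S"
  then obtain r c where r: "r > 0" "ball p r \<subseteq> S"
    and c: "\<And>z. z \<in> ball p r \<Longrightarrow>
      ((\<lambda>(m, n). c m n * Re (z - p) ^ m * Im (z - p) ^ n) has_sum f z) UNIV"
    using assms(1) unfolding real_analytic_on_def by blast
  have "((\<lambda>(m, n). c m n * Re (z - p) ^ m * Im (z - p) ^ n) has_sum g z) UNIV"
    if "z \<in> ball p r" for z
    using c[OF that] eq[of z] r(2) that by auto
  then show "\<exists>r>0. \<exists>c. ball p r \<subseteq> S \<and> (\<forall>z\<in>ball p r.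
      ((\<lambda>(m, n). c m n * Re (z - p) ^ m * Im (z - p) ^ n) has_sum g z) UNIV)"
    using r by blast
qed

lemma real_analytic_on_add:
  assumes "real_analytic_on f S" "real_analytic_on g S"
  shows "real_analytic_on (\<lambda>z. f z + g z) S"
  unfolding real_analytic_on_def
proof
  fix p assume p: "p \<in> S"
  obtain r c where r: "r > 0" "ball p r \<subseteq> S"
    and c: "\<And>z. z \<in> ball p r \<Longrightarrow>
      ((\<lambda>(m, n). c m n * Re (z - p) ^ m * Im (z - p) ^ n) has_sum f z) UNIV"
    using assms(1) p unfolding real_analytic_on_def by blast
  obtain r' c' where r': "r' > 0"
    and c': "\<And>z. z \<in> ball p r' \<Longrightarrow>
      ((\<lambda>(m, n). c' m n * Re (z - p) ^ m * Im (z - p) ^ n) has_sum g z) UNIV"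
    using assms(2) p unfolding real_analytic_on_def by blast
  have "((\<lambda>(m, n). (c m n + c' m n) * Re (z - p) ^ m * Im (z - p) ^ n) has_sum f z + g z) UNIV"
    if "z \<in> ball p (min r r')" for z
    using has_sum_add[OF c[of z] c'[of z]] that by (simp add: case_prod_unfold distrib_right)
  then show "\<exists>r>0. \<exists>c. ball p r \<subseteq> S \<and> (\<forall>z\<in>ball p r.
      ((\<lambda>(m, n). c m n * Re (z - p) ^ m * Im (z - p) ^ n) has_sum f z + g z) UNIV)"
    using r r' by (intro exI[of _ "min r r'"] exI[of _ "\<lambda>m n. c m n + c' m n"] conjI ballI) auto
qed

lemma real_analytic_on_cmult:
  assumes "real_analytic_on f S"
  shows "real_analytic_on (\<lambda>z. k * f z) S"
  unfolding real_analytic_on_def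
proof
  fix p assume p: "p \<in> S"
  obtain r c where r: "r > 0" "ball p r \<subseteq> S"
    and c: "\<And>z. z \<in> ball p r \<Longrightarrow>
      ((\<lambda>(m, n). c m n * Re (z - p) ^ m * Im (z - p) ^ n) has_sum f z) UNIV"
    using assms p unfolding real_analytic_on_def by blast
  have "((\<lambda>(m, n). (k * c m n) * Re (z - p) ^ m * Im (z - p) ^ n) has_sum k * f z) UNIV"
    if "z \<in> ball p r" for z
    using has_sum_cmult_right[OF c[OF that], of k] by (simp add: case_prod_unfold mult_ac)
  then show "\<exists>r>0. \<exists>c. ball p r \<subseteq> S \<and> (\<forall>z\<in>ball p r.
      ((\<lambda>(m, n). c m n * Re (z - p) ^ m * Im (z - p) ^ n) has_sum k * f z) UNIV)"
    using r by (intro exI[of _ r] exI[of _ "\<lambda>m n. k * c m n"] conjI ballI) auto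
qed

lemma real_analytic_on_quadratic:
  assumes "open S"
  shows "real_analytic_on (\<lambda>z. A * (Re z)\<^sup>2 + B * (Im z)\<^sup>2 + C * Re z * Im z) S"
  unfolding real_analytic_on_def
proof
  fix p assume "p \<in> S"
  then obtain r where r: "r > 0" "ball p r \<subseteq> S"
    using assms open_contains_ball by blast
  define x y where "x = Re p" and "y = Im p"
  \<comment> \<open>The Taylor coefficients of the quadratic form at \<open>p\<close>.\<close>
  define c :: "nat \<Rightarrow> nat \<Rightarrow> real" where "c m n =
    (if (m, n) = (0, 0) then A * x\<^sup>2 + B * y\<^sup>2 + C * x * y
     else if (m, n) = (1, 0) then 2 * A * x + C * y
     else if (m, n) = (0, 1) then 2 * B * y + C * x
     else if (m, n) = (2, 0) then A
     else if (m, n) = (0, 2) then B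
     else if (m, n) = (1, 1) then C else 0)" for m n
  define T :: "(nat \<times> nat) set" where "T = {(0, 0), (1, 0), (0, 1), (2, 0), (0, 2), (1, 1)}"
  have "((\<lambda>(m, n). c m n * Re (z - p) ^ m * Im (z - p) ^ n) has_sum
          A * (Re z)\<^sup>2 + B * (Im z)\<^sup>2 + C * Re z * Im z) UNIV" for z
  proof (rule has_sum_finite_neutralI)
    show "finite T" "T \<subseteq> UNIV"
      by (auto simp: T_def)
    show "(case q of (m, n) \<Rightarrow> c m n * Re (z - p) ^ m * Im (z - p) ^ n) = 0" if "q \<in> UNIV - T" for q
      using that by (cases q) (auto simp: T_def c_def)
    have "Re z = x + Re (z - p)" "Im z = y + Im (z - p)"
      by (simp_all add: x_def y_def)
    then show "A * (Re z)\<^sup>2 + B * (Im z)\<^sup>2 + C * Re z * Im z =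
        (\<Sum>(m, n)\<in>T. c m n * Re (z - p) ^ m * Im (z - p) ^ n)"
      by (simp add: T_def c_def power2_eq_square del: minus_complex.sel) (simp add: algebra_simps)
  qed
  then show "\<exists>r>0. \<exists>c. ball p r \<subseteq> S \<and> (\<forall>z\<in>ball p r.
      ((\<lambda>(m, n). c m n * Re (z - p) ^ m * Im (z - p) ^ n) has_sum
        A * (Re z)\<^sup>2 + B * (Im z)\<^sup>2 + C * Re z * Im z) UNIV)"
    using r by blast
qed

text \<open>Each power of x + i y is expanded binomially and the triangle of pairs (k, j) is
  reindexed by m = k - j, n = j. The absolute values in row k add up to |c_k| (|x| + |y|)^k, so
  unconditional convergence is governed by |x| + |y| rather than by the modulus of x + i y.\<close>

lemma power_series_has_sum_binomial:
  fixes c :: "nat \<Rightarrow> complex" and x y :: real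
  assumes abs: "summable (\<lambda>k. norm (c k) * (\<bar>x\<bar> + \<bar>y\<bar>) ^ k)"
    and sums: "(\<lambda>k. c k * Complex x y ^ k) sums s"
  shows "((\<lambda>(m, n). c (m + n) * of_nat ((m + n) choose n) * \<i> ^ n * of_real x ^ m * of_real y ^ n)
            has_sum s) UNIV"
proof -
  define f :: "nat \<times> nat \<Rightarrow> complex" where
    "f = (\<lambda>(k, j). c k * (of_nat (k choose j) * (\<i> * of_real y) ^ j * of_real x ^ (k - j)))"
  have f_nonneg_sum: "(\<Sum>j\<le>k. norm (f (k, j))) = norm (c k) * (\<bar>x\<bar> + \<bar>y\<bar>) ^ k" for k
    by (simp add: f_def norm_mult norm_power sum_distrib_left[symmetric] binomial_ring
        add.commute[of "\<bar>x\<bar>"])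
  have f_sum: "(\<Sum>j\<le>k. f (k, j)) = c k * Complex x y ^ k" for k
    by (simp add: f_def sum_distrib_left[symmetric] binomial_ring[symmetric] Complex_eq add.commute)
  have "(\<lambda>k. norm (c k) * (\<bar>x\<bar> + \<bar>y\<bar>) ^ k) summable_on UNIV"
    using abs by (intro norm_summable_imp_summable_on) (simp add: abs_mult)
  then have "(\<lambda>q. norm (f q)) summable_on (SIGMA k:UNIV. {..k})"
    by (intro summable_on_SigmaI[where g = "\<lambda>k. norm (c k) * (\<bar>x\<bar> + \<bar>y\<bar>) ^ k"])
       (auto intro!: has_sum_finiteI simp: f_nonneg_sum)
  then have summable: "f summable_on (SIGMA k:UNIV. {..k})"
    by (rule Infinite_Sum.abs_summable_summable)
  have "(f has_sum s) (SIGMA k:UNIV. {..k})"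
  proof (rule has_sum_SigmaI[OF _ _ summable])
    show "((\<lambda>j. f (k, j)) has_sum c k * Complex x y ^ k) {..k}" for k
      by (intro has_sum_finiteI) (simp_all add: f_sum)
    have "norm (c k * Complex x y ^ k) \<le> norm (c k) * (\<bar>x\<bar> + \<bar>y\<bar>) ^ k" for k
      using cmod_le[of "Complex x y"]
      by (auto simp: norm_mult norm_power intro!: mult_left_mono power_mono)
    then have "summable (\<lambda>k. norm (c k * Complex x y ^ k))"
      by (intro summable_comparison_test'[OF abs, of 0]) simp
    then show "((\<lambda>k. c k * Complex x y ^ k) has_sum s) UNIV"
      using sums by (rule norm_summable_imp_has_sum)
  qed
  also have "(f has_sum s) (SIGMA k:UNIV. {..k}) \<longleftrightarrow>
    ((\<lambda>(m, n). c (m + n) * of_nat ((m + n) choose n) * \<i> ^ n * of_real x ^ m * of_real y ^ n)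
            has_sum s) UNIV"
    by (rule has_sum_reindex_bij_witness[of _ "\<lambda>(m, n). (m + n, n)" "\<lambda>(k, j). (k - j, j)"])
       (auto simp: f_def power_mult_distrib mult_ac)
  finally show ?thesis .
qed

lemma real_analytic_on_Re_local:
  assumes "open S"
    and loc: "\<And>p. p \<in> S \<Longrightarrow> \<exists>h R. R > 0 \<and> h holomorphic_on ball p R \<and> (\<forall>z\<in>ball p R. f z = Re (h z))"
  shows "real_analytic_on f S"
  unfolding real_analytic_on_def
proof
  fix p assume p: "p \<in> S"
  obtain h R where R: "R > 0" and h: "h holomorphic_on ball p R"
    and fh: "\<And>z. z \<in> ball p R \<Longrightarrow> f z = Re (h z)"
    using loc[OF p] by blast
  obtain e where e: "e > 0" "ball p e \<subseteq> S"
    using \<open>open S\<close> p open_contains_ball by blast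
  \<comment> \<open>Half the radius, since |x| + |y| is at most twice the modulus and must stay
    below \<open>R\<close>.\<close>
  define r where "r = min e (R / 2)"
  define c where "c k = (deriv ^^ k) h p / fact k" for k
  define d where "d m n = Re (c (m + n) * of_nat ((m + n) choose n) * \<i> ^ n)" for m n :: nat
  have "((\<lambda>(m, n). d m n * Re (z - p) ^ m * Im (z - p) ^ n) has_sum f z) UNIV"
    if z: "z \<in> ball p r" for z
  proof -
    define x y where "x = Re (z - p)" and "y = Im (z - p)"
    have xy: "Complex x y = z - p"
      by (simp add: x_def y_def complex_eq_iff)
    have z_in: "z \<in> ball p R" and dist: "norm (z - p) < R / 2"
      using z R by (auto simp: r_def dist_norm norm_minus_commute)
    have "\<bar>x\<bar> + \<bar>y\<bar> < R"
      using dist abs_Re_le_cmod[of "z - p"] abs_Im_le_cmod[of "z - p"] by (simp add: x_def y_def)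
    \<comment> \<open>Convergence at the larger radius \<open>t\<close> yields absolute convergence
      at |x| + |y|.\<close>
    then obtain t where t: "\<bar>x\<bar> + \<bar>y\<bar> < t" "t < R"
      using dense by blast
    then have "p + of_real t \<in> ball p R"
      by (auto simp: dist_norm)
    from holomorphic_power_series[OF h this] have "summable (\<lambda>k. c k * of_real t ^ k)"
      by (auto simp: c_def sums_iff)
    then have "summable (\<lambda>k. norm (c k * of_real (\<bar>x\<bar> + \<bar>y\<bar>) ^ k))"
      by (rule powser_insidea) (use t in \<open>simp del: of_real_add\<close>)
    then have "summable (\<lambda>k. norm (c k) * (\<bar>x\<bar> + \<bar>y\<bar>) ^ k)"
      by (simp add: norm_mult norm_power del: of_real_add)
    moreover have "(\<lambda>k. c k * Complex x y ^ k) sums h z"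
      using holomorphic_power_series[OF h z_in] by (simp add: c_def xy)
    ultimately have "((\<lambda>(m, n). c (m + n) * of_nat ((m + n) choose n) * \<i> ^ n * of_real x ^ m * of_real y ^ n)
            has_sum h z) UNIV"
      by (rule power_series_has_sum_binomial)
    from has_sum_bounded_linear[OF bounded_linear_Re this]
    have "((\<lambda>(m, n). d m n * x ^ m * y ^ n) has_sum Re (h z)) UNIV"
      by (simp add: o_def case_prod_unfold d_def flip: of_real_power)
    then show ?thesis
      using fh[OF z_in] by (simp add: x_def y_def)
  qed
  moreover have "r > 0" "ball p r \<subseteq> S"
    using e R by (auto simp: r_def)
  ultimately show "\<exists>r>0. \<exists>c. ball p r \<subseteq> S \<and> (\<forall>z\<in>ball p r.
      ((\<lambda>(m, n). c m n * Re (z - p) ^ m * Im (z - p) ^ n) has_sum f z) UNIV)"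
    by blast
qed

text \<open>On a disc a zero-free holomorphic function has a holomorphic logarithm, whose real part
  is ln |f|.\<close>

lemma real_analytic_on_ln_norm:
  assumes hol: "f holomorphic_on S" and "open S" and nz: "\<And>z. z \<in> S \<Longrightarrow> f z \<noteq> 0"
  shows "real_analytic_on (\<lambda>z. ln (norm (f z))) S"
proof (rule real_analytic_on_Re_local[OF \<open>open S\<close>])
  fix p assume "p \<in> S"
  then obtain R where R: "R > 0" "ball p R \<subseteq> S"
    using \<open>open S\<close> open_contains_ball by blast
  then have "f holomorphic_on ball p R" "\<And>z. z \<in> ball p R \<Longrightarrow> f z \<noteq> 0"
    using hol nz holomorphic_on_subset by blast+
  then obtain h where "h holomorphic_on ball p R" "\<And>z. z \<in> ball p R \<Longrightarrow> f z = exp (h z)"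
    by (metis simply_connected_eq_holomorphic_log[OF open_ball] convex_ball convex_imp_simply_connected)
  then show "\<exists>h R. R > 0 \<and> h holomorphic_on ball p R \<and> (\<forall>z\<in>ball p R. ln (norm (f z)) = Re (h z))"
    using R(1) by (intro exI[of _ h] exI[of _ R]) simp
qed

section \<open>The rhombic lattice\<close>

text \<open>The exponent 3/2 splits the cube evenly between the two lattice coordinates and still
  exceeds 1. The shift by 1 keeps the base positive at m = 0.\<close>

lemma summable_on_int_powr: "(\<lambda>m::int. (1 + \<bar>real_of_int m\<bar>) powr (- 3 / 2)) summable_on UNIV"
proof -
  let ?g = "\<lambda>m::int. (1 + \<bar>real_of_int m\<bar>) powr (- 3 / 2)"
  have "summable (\<lambda>n. real (Suc n) powr (- 3 / 2))"
    by (subst summable_Suc_iff) (simp add: summable_real_powr_iff)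
  then have "(\<lambda>n. real (Suc n) powr (- 3 / 2)) summable_on UNIV"
    by (intro norm_summable_imp_summable_on) simp
  then have *: "?g \<circ> int summable_on UNIV" "?g \<circ> (\<lambda>n. - int n) summable_on UNIV"
    by (simp_all add: o_def)
  then have "?g summable_on range int" "?g summable_on range (\<lambda>n. - int n)"
    by (subst summable_on_reindex; simp add: inj_on_def)+
  then have "?g summable_on range int \<union> range (\<lambda>n. - int n)"
    by (rule summable_on_union)
  moreover have "m \<in> range int \<union> range (\<lambda>n. - int n)" for m
    by (cases m rule: int_cases2) auto
  then have "range int \<union> range (\<lambda>n. - int n) = UNIV"
    by blast
  ultimately show ?thesis
    by simp
qed

lemma summable_on_int_powr_product:
  "(\<lambda>(m::int, n::int). (1 + \<bar>real_of_int m\<bar>) powr (- 3 / 2) * (1 + \<bar>real_of_int n\<bar>) powr (- 3 / 2))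
     summable_on UNIV"
proof -
  let ?g = "\<lambda>m::int. (1 + \<bar>real_of_int m\<bar>) powr (- 3 / 2)"
  have "(\<lambda>(m, n). ?g m * ?g n) summable_on (SIGMA m:UNIV. UNIV)"
  proof (rule summable_on_SigmaI)
    show "((\<lambda>n. case (m, n) of (m, n) \<Rightarrow> ?g m * ?g n) has_sum ?g m * infsum ?g UNIV) UNIV" for m
      using has_sum_cmult_right[OF has_sum_infsum[OF summable_on_int_powr]] by simp
    show "(\<lambda>m. ?g m * infsum ?g UNIV) summable_on UNIV"
      by (intro summable_on_cmult_left summable_on_int_powr)
  qed auto
  then show ?thesis
    by simp
qed

locale rhombic_lattice =
  fixes a b :: real and \<omega>\<^sub>1 \<omega>\<^sub>2 :: complex
  assumes a_pos: "a > 0" and b_pos: "b > 0"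
    and \<omega>\<^sub>1: "\<omega>\<^sub>1 = of_real a - \<i> * of_real b"
    and \<omega>\<^sub>2: "\<omega>\<^sub>2 = of_real a + \<i> * of_real b"
begin

lemma Re_Im_half_periods:
  "Re \<omega>\<^sub>1 = a" "Im \<omega>\<^sub>1 = - b" "Re \<omega>\<^sub>2 = a" "Im \<omega>\<^sub>2 = b"
  by (simp_all add: \<omega>\<^sub>1 \<omega>\<^sub>2)

definition point :: "int \<times> int \<Rightarrow> complex" where
  "point = (\<lambda>(m, n). 2 * of_int m * \<omega>\<^sub>1 + 2 * of_int n * \<omega>\<^sub>2)"

lemma period_lattice_eq: "period_lattice \<omega>\<^sub>1 \<omega>\<^sub>2 = range point"
  by (auto simp: period_lattice_def point_def)

lemma Re_point: "Re (point (m, n)) = 2 * a * of_int (m + n)"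
  and Im_point: "Im (point (m, n)) = 2 * b * of_int (n - m)"
  unfolding point_def by (simp_all add: Re_Im_half_periods algebra_simps)

lemma inj_point: "inj point"
proof (rule injI)
  fix q r assume "point q = point r"
  moreover obtain m n k l where "q = (m, n)" "r = (k, l)"
    by (cases q, cases r) blast
  ultimately have eq: "point (m, n) = point (k, l)" and qr: "q = (m, n)" "r = (k, l)"
    by simp_all
  have "m + n = k + l" "n - m = l - k"
    using arg_cong[OF eq, of Re] arg_cong[OF eq, of Im] a_pos b_pos
    by (simp_all only: Re_point Im_point) simp_all
  then show "q = r"
    by (simp add: qr)
qed

lemma point_zero: "point (0, 0) = 0"
  by (simp add: point_def)

text \<open>The real part controls |m + n|, the imaginary part |n - m|, and twice |m| or |n| is at
  most the sum of these two.\<close>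

lemma norm_point_ge:
  "2 * min a b * \<bar>real_of_int m\<bar> \<le> norm (point (m, n))"
  "2 * min a b * \<bar>real_of_int n\<bar> \<le> norm (point (m, n))"
proof -
  define d where "d = min a b"
  have d: "d > 0" "d \<le> a" "d \<le> b"
    using a_pos b_pos by (auto simp: d_def)
  have "2 * d * \<bar>real_of_int (m + n)\<bar> \<le> \<bar>Re (point (m, n))\<bar>"
    using d by (simp add: Re_point abs_mult mult_right_mono)
  then have 1: "2 * d * \<bar>real_of_int (m + n)\<bar> \<le> norm (point (m, n))"
    using abs_Re_le_cmod order_trans by blast
  have "2 * d * \<bar>real_of_int (n - m)\<bar> \<le> \<bar>Im (point (m, n))\<bar>"
    using d by (simp add: Im_point abs_mult mult_right_mono)
  then have 2: "2 * d * \<bar>real_of_int (n - m)\<bar> \<le> norm (point (m, n))"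
    using abs_Im_le_cmod order_trans by blast
  have "2 * d * (2 * \<bar>real_of_int m\<bar>) \<le> 2 * d * (\<bar>real_of_int (m + n)\<bar> + \<bar>real_of_int (n - m)\<bar>)"
    "2 * d * (2 * \<bar>real_of_int n\<bar>) \<le> 2 * d * (\<bar>real_of_int (m + n)\<bar> + \<bar>real_of_int (n - m)\<bar>)"
    using d by (intro mult_left_mono; simp)+
  with 1 2 show "2 * min a b * \<bar>real_of_int m\<bar> \<le> norm (point (m, n))"
    "2 * min a b * \<bar>real_of_int n\<bar> \<le> norm (point (m, n))"
    by (simp_all add: d_def[symmetric] distrib_left)
qed

text \<open>With t = |point| / min a b one has 2 |m| \<le> t and 2 |n| \<le> t. As one of |m|, |n|
  is at least 1, also t \<ge> 2, so both 1 + |m| and 1 + |n| are at most t; their powers of exponent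
  3/2 multiply to at most t^3.\<close>

lemma inverse_cube_point_le:
  assumes "(m, n) \<noteq> (0, 0)"
  shows "1 / norm (point (m, n)) ^ 3 \<le> 1 / min a b ^ 3 *
    ((1 + \<bar>real_of_int m\<bar>) powr (- 3 / 2) * (1 + \<bar>real_of_int n\<bar>) powr (- 3 / 2))"
proof -
  define d where "d = min a b"
  define u v where "u = 1 + \<bar>real_of_int m\<bar>" and "v = 1 + \<bar>real_of_int n\<bar>"
  define t where "t = norm (point (m, n)) / d"
  have d: "d > 0"
    using a_pos b_pos by (simp add: d_def)
  have mn: "2 * \<bar>real_of_int m\<bar> \<le> t" "2 * \<bar>real_of_int n\<bar> \<le> t"
    using norm_point_ge[of m n] norm_point_ge[of n m] d
    by (simp_all add: t_def d_def[symmetric] field_simps)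
  have "\<bar>m\<bar> \<ge> 1 \<or> \<bar>n\<bar> \<ge> 1"
    using assms by auto
  then have "\<bar>real_of_int m\<bar> \<ge> 1 \<or> \<bar>real_of_int n\<bar> \<ge> 1"
    by linarith
  then have uv: "0 < u" "0 < v" "u \<le> t" "v \<le> t"
    using mn by (auto simp: u_def v_def)
  then have "u powr (3 / 2) * v powr (3 / 2) \<le> t powr (3 / 2) * t powr (3 / 2)"
    by (intro mult_mono powr_mono2) auto
  also have "\<dots> = t ^ 3"
    using uv by (simp flip: powr_add)
  finally have "1 / t ^ 3 \<le> 1 / (u powr (3 / 2) * v powr (3 / 2))"
    using uv by (intro divide_left_mono) auto
  moreover have "1 / norm (point (m, n)) ^ 3 = 1 / d ^ 3 * (1 / t ^ 3)"
    using d by (simp add: t_def power_divide)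
  ultimately have "1 / norm (point (m, n)) ^ 3 \<le> 1 / d ^ 3 * (1 / (u powr (3 / 2) * v powr (3 / 2)))"
    using d by (simp only:) (intro mult_left_mono; simp)
  also have "1 / (u powr (3 / 2) * v powr (3 / 2)) = u powr (- 3 / 2) * v powr (- 3 / 2)"
    by (simp add: powr_minus_divide)
  finally show ?thesis
    by (simp only: d_def u_def v_def)
qed

sublocale summable_lattice "period_lattice \<omega>\<^sub>1 \<omega>\<^sub>2"
proof
  show "0 \<in> period_lattice \<omega>\<^sub>1 \<omega>\<^sub>2"
    unfolding period_lattice_eq using point_zero by (metis rangeI)
  show "k + l \<in> period_lattice \<omega>\<^sub>1 \<omega>\<^sub>2"
    if "k \<in> period_lattice \<omega>\<^sub>1 \<omega>\<^sub>2" "l \<in> period_lattice \<omega>\<^sub>1 \<omega>\<^sub>2" for k l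
  proof -
    obtain m n m' n' where "k = point (m, n)" "l = point (m', n')"
      using \<open>k \<in> _\<close> \<open>l \<in> _\<close> unfolding period_lattice_eq by auto
    then have "k + l = point (m + m', n + n')"
      by (simp add: point_def algebra_simps)
    then show ?thesis
      by (simp add: period_lattice_eq)
  qed
  show "- l \<in> period_lattice \<omega>\<^sub>1 \<omega>\<^sub>2" if l: "l \<in> period_lattice \<omega>\<^sub>1 \<omega>\<^sub>2" for l
  proof -
    obtain m n where "l = point (m, n)"
      using l unfolding period_lattice_eq by auto
    then have "- l = point (- m, - n)"
      by (simp add: point_def algebra_simps)
    then show ?thesis
      by (simp add: period_lattice_eq)
  qed
  have "infinite (UNIV :: (int \<times> int) set)"
    by (simp add: finite_prod)
  then show "infinite (period_lattice \<omega>\<^sub>1 \<omega>\<^sub>2)"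
    unfolding period_lattice_eq using inj_point finite_imageD by blast
  have range: "period_lattice \<omega>\<^sub>1 \<omega>\<^sub>2 - {0} = point ` (UNIV - {(0, 0)})"
    unfolding period_lattice_eq
    using image_set_diff[OF inj_point, of UNIV "{(0, 0)}"] by (simp add: point_zero)
  have "(\<lambda>q. 1 / norm (point q) ^ 3) summable_on (UNIV - {(0, 0)})"
  proof (rule summable_on_comparison_test)
    show "(\<lambda>q. 1 / min a b ^ 3 * (case q of (m, n) \<Rightarrow>
        (1 + \<bar>real_of_int m\<bar>) powr (- 3 / 2) * (1 + \<bar>real_of_int n\<bar>) powr (- 3 / 2)))
        summable_on (UNIV - {(0, 0)})"
      using summable_on_int_powr_product
      by (intro summable_on_cmult_right) (rule summable_on_subset, auto)
    show "1 / norm (point q) ^ 3 \<le> 1 / min a b ^ 3 * (case q of (m, n) \<Rightarrow>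
        (1 + \<bar>real_of_int m\<bar>) powr (- 3 / 2) * (1 + \<bar>real_of_int n\<bar>) powr (- 3 / 2))"
      if "q \<in> UNIV - {(0, 0)}" for q
      using that inverse_cube_point_le by (cases q) simp
  qed simp
  then show "(\<lambda>l. 1 / norm l ^ 3) summable_on (period_lattice \<omega>\<^sub>1 \<omega>\<^sub>2 - {0})"
    unfolding range
    by (subst summable_on_reindex) (use inj_point in \<open>auto simp: o_def intro: inj_on_subset\<close>)
qed

lemma half_periods:
  "2 * \<omega>\<^sub>1 \<in> period_lattice \<omega>\<^sub>1 \<omega>\<^sub>2" "2 * \<omega>\<^sub>2 \<in> period_lattice \<omega>\<^sub>1 \<omega>\<^sub>2"
  "2 * (\<omega>\<^sub>1 + \<omega>\<^sub>2) \<in> period_lattice \<omega>\<^sub>1 \<omega>\<^sub>2"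
proof -
  have "2 * \<omega>\<^sub>1 = point (1, 0)" "2 * \<omega>\<^sub>2 = point (0, 1)" "2 * (\<omega>\<^sub>1 + \<omega>\<^sub>2) = point (1, 1)"
    by (simp_all add: point_def)
  then show "2 * \<omega>\<^sub>1 \<in> period_lattice \<omega>\<^sub>1 \<omega>\<^sub>2" "2 * \<omega>\<^sub>2 \<in> period_lattice \<omega>\<^sub>1 \<omega>\<^sub>2"
    "2 * (\<omega>\<^sub>1 + \<omega>\<^sub>2) \<in> period_lattice \<omega>\<^sub>1 \<omega>\<^sub>2"
    by (simp_all only: period_lattice_eq rangeI)
qed

text \<open>By parity of the coordinates: a sum m + n = 1 contradicts m = n, and a real part - a is
  no multiple of 2 a. Hence 0 is no pole, as the normalisation at 0 requires, and neither are the
  half periods at which evenness is exploited.\<close>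

lemma half_periods_notin:
  "\<omega>\<^sub>1 + \<omega>\<^sub>2 \<notin> period_lattice \<omega>\<^sub>1 \<omega>\<^sub>2"
  "\<omega>\<^sub>1 \<notin> poles (\<omega>\<^sub>1 + \<omega>\<^sub>2)" "\<omega>\<^sub>2 \<notin> poles (\<omega>\<^sub>1 + \<omega>\<^sub>2)"
proof -
  have "\<omega>\<^sub>1 + \<omega>\<^sub>2 \<noteq> point (m, n)" "\<omega>\<^sub>1 - (\<omega>\<^sub>1 + \<omega>\<^sub>2) \<noteq> point (m, n)" "\<omega>\<^sub>2 - (\<omega>\<^sub>1 + \<omega>\<^sub>2) \<noteq> point (m, n)" for m n
  proof -
    have half: "2 * of_int k \<noteq> (- 1 :: real)" for k :: int
    proof
      assume "2 * of_int k = (- 1 :: real)"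
      then have "2 * k = - 1"
        by linarith
      then show False
        by presburger
    qed
    show "\<omega>\<^sub>1 + \<omega>\<^sub>2 \<noteq> point (m, n)"
    proof
      assume eq: "\<omega>\<^sub>1 + \<omega>\<^sub>2 = point (m, n)"
      have "2 * a = 2 * a * of_int (m + n)" "0 = 2 * b * of_int (n - m)"
        using arg_cong[OF eq, of Re] arg_cong[OF eq, of Im]
        unfolding Re_point Im_point by (simp_all add: Re_Im_half_periods)
      then have "of_int (m + n) = (1 :: real)" "of_int (n - m) = (0 :: real)"
        using a_pos b_pos by auto
      then have "m + n = 1" "n - m = 0"
        by linarith+
      then show False
        by presburger
    qed
    show "\<omega>\<^sub>1 - (\<omega>\<^sub>1 + \<omega>\<^sub>2) \<noteq> point (m, n)"
    proof
      assume eq: "\<omega>\<^sub>1 - (\<omega>\<^sub>1 + \<omega>\<^sub>2) = point (m, n)"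
      have "a * (2 * of_int (m + n)) = a * (- 1)"
        using arg_cong[OF eq, of Re] unfolding Re_point by (simp add: Re_Im_half_periods)
      then show False
        using a_pos half[of "m + n"] by (simp only: mult_cancel_left) simp
    qed
    show "\<omega>\<^sub>2 - (\<omega>\<^sub>1 + \<omega>\<^sub>2) \<noteq> point (m, n)"
    proof
      assume eq: "\<omega>\<^sub>2 - (\<omega>\<^sub>1 + \<omega>\<^sub>2) = point (m, n)"
      have "a * (2 * of_int (m + n)) = a * (- 1)"
        using arg_cong[OF eq, of Re] unfolding Re_point by (simp add: Re_Im_half_periods)
      then show False
        using a_pos half[of "m + n"] by (simp only: mult_cancel_left) simp
    qed
  qed
  then have "\<omega>\<^sub>1 + \<omega>\<^sub>2 \<notin> range point" "\<omega>\<^sub>1 - (\<omega>\<^sub>1 + \<omega>\<^sub>2) \<notin> range point"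
    "\<omega>\<^sub>2 - (\<omega>\<^sub>1 + \<omega>\<^sub>2) \<notin> range point"
    by (metis rangeE surj_pair)+
  then show "\<omega>\<^sub>1 + \<omega>\<^sub>2 \<notin> period_lattice \<omega>\<^sub>1 \<omega>\<^sub>2"
    "\<omega>\<^sub>1 \<notin> poles (\<omega>\<^sub>1 + \<omega>\<^sub>2)" "\<omega>\<^sub>2 \<notin> poles (\<omega>\<^sub>1 + \<omega>\<^sub>2)"
    by (simp_all add: poles_def flip: period_lattice_eq)
qed

section \<open>Evaluation of the symmetric zeta-function and of its integral\<close>

abbreviation "s \<equiv> \<omega>\<^sub>1 + \<omega>\<^sub>2"
abbreviation "e \<equiv> e\<^sub>3 \<omega>\<^sub>1 \<omega>\<^sub>2"

lemma karcher_poles_eq: "karcher_poles \<omega>\<^sub>1 \<omega>\<^sub>2 = poles s"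
proof (rule set_eqI)
  fix z
  have "z \<in> karcher_poles \<omega>\<^sub>1 \<omega>\<^sub>2 \<longleftrightarrow> (\<exists>l. z = s + l \<and> l \<in> period_lattice \<omega>\<^sub>1 \<omega>\<^sub>2)"
    by (simp only: karcher_poles_def mem_Collect_eq)
  also have "\<dots> \<longleftrightarrow> z \<in> poles s"
    by (metis poles_def mem_Collect_eq add_diff_cancel_left' diff_add_cancel)
  finally show "z \<in> karcher_poles \<omega>\<^sub>1 \<omega>\<^sub>2 \<longleftrightarrow> z \<in> poles s" .
qed

lemma paths_avoiding_poles_nonempty: "w \<notin> poles s \<Longrightarrow> paths_avoiding (poles s) w \<noteq> {}"
  by (rule paths_avoiding_nonempty[OF open_Compl_poles connected_Compl_poles
        zero_notin_poles[OF half_periods_notin(1)]])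

text \<open>The negative of the right-hand side is a primitive of \<open>karcher_p\<close> off the
  poles that vanishes at 0, so it is the integral along every admissible path. If the constant is 0,
  both sides are 0 by x / 0 = 0.\<close>

lemma karcher_zeta_eq:
  assumes "z \<notin> poles s"
  shows "karcher_zeta \<omega>\<^sub>1 \<omega>\<^sub>2 z = kzeta s e z / karcher_const \<omega>\<^sub>1 \<omega>\<^sub>2"
proof -
  let ?c = "karcher_const \<omega>\<^sub>1 \<omega>\<^sub>2"
  have int: "(karcher_p \<omega>\<^sub>1 \<omega>\<^sub>2 has_contour_integral - (kzeta s e z / ?c)) g"
    if "g \<in> paths_avoiding (poles s) z" for g
  proof -
    have "((\<lambda>z. - (kzeta s e z / ?c)) has_field_derivative karcher_p \<omega>\<^sub>1 \<omega>\<^sub>2 z) (at z)"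
      if "z \<notin> poles s" for z
      by (rule DERIV_cong[OF DERIV_minus[OF DERIV_cdivide[OF kzeta_derivative[OF that, of e]]]])
         (simp add: karcher_p_def diff_diff_eq diff_divide_distrib)
    from has_contour_integral_paths_avoiding[OF this that] show ?thesis
      by simp
  qed
  have "(THE v. \<forall>g\<in>paths_avoiding (poles s) z. (karcher_p \<omega>\<^sub>1 \<omega>\<^sub>2 has_contour_integral v) g)
          = - (kzeta s e z / ?c)"
  proof (rule the_equality)
    fix v
    assume v: "\<forall>g\<in>paths_avoiding (poles s) z. (karcher_p \<omega>\<^sub>1 \<omega>\<^sub>2 has_contour_integral v) g"
    obtain g where "g \<in> paths_avoiding (poles s) z"
      using paths_avoiding_poles_nonempty[OF assms] by blast
    then show "v = - (kzeta s e z / ?c)"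
      using v int has_contour_integral_unique by blast
  qed (use int in blast)
  then show ?thesis
    by (simp add: karcher_zeta_def karcher_poles_eq)
qed

text \<open>The factor covers the junk case of a vanishing constant, where \<open>x / 0 = 0\<close> makes the
  zeta-function vanish. Since the constant otherwise cancels, its value is irrelevant.\<close>

definition scale :: real where
  "scale = (if karcher_const \<omega>\<^sub>1 \<omega>\<^sub>2 = 0 then 0 else - (1 / (2 * pi)))"

text \<open>Multiplication by a nonzero constant undoes the division in zeta and leaves
  \<open>kzeta\<close>, the logarithmic derivative of \<open>ksigma\<close>. As
  \<open>ksigma\<close> is 1 at 0, only the end point contributes to the real part.\<close>

lemma Z_fun_eq:
  "Z_fun \<omega>\<^sub>1 \<omega>\<^sub>2 w = (if w \<in> poles s then \<infinity> else ereal (scale * ln (norm (ksigma s e w))))"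
proof (cases "w \<in> poles s")
  case False
  let ?c = "karcher_const \<omega>\<^sub>1 \<omega>\<^sub>2"
  define r where "r = (if ?c = 0 then 0 else ln (norm (ksigma s e w)))"
  have int: "\<exists>v. ((\<lambda>z. ?c * karcher_zeta \<omega>\<^sub>1 \<omega>\<^sub>2 z) has_contour_integral v) g \<and> r = Re v"
    if g: "g \<in> paths_avoiding (poles s) w" for g
  proof (cases "?c = 0")
    case True
    then show ?thesis
      by (intro exI[of _ 0]) (simp add: r_def has_contour_integral_0)
  next
    case c: False
    have g': "valid_path g" "path_image g \<subseteq> - poles s" "pathstart g = 0" "pathfinish g = w"
      using g by (auto simp: paths_avoiding_def)
    have "ksigma s e z \<noteq> 0" if "z \<in> - poles s" for z
      using that half_periods_notin(1) by (simp add: ksigma_nonzero)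
    then obtain v where v: "((\<lambda>z. deriv (ksigma s e) z / ksigma s e z) has_contour_integral v) g"
      and Re_v: "Re v = ln (norm (ksigma s e (pathfinish g))) - ln (norm (ksigma s e (pathstart g)))"
      by (rule Re_contour_integral_logderiv[OF ksigma_holomorphic open_Compl_poles _ g'(1,2)])
    have "((\<lambda>z. ?c * karcher_zeta \<omega>\<^sub>1 \<omega>\<^sub>2 z) has_contour_integral v) g"
    proof (rule has_contour_integral_eq[OF v])
      fix z assume "z \<in> path_image g"
      then have z: "z \<notin> poles s"
        using g'(2) by auto
      then have "deriv (ksigma s e) z = ksigma s e z * kzeta s e z"
        by (intro DERIV_imp_deriv ksigma_derivative)
      then show "deriv (ksigma s e) z / ksigma s e z = ?c * karcher_zeta \<omega>\<^sub>1 \<omega>\<^sub>2 z"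
        using z c ksigma_nonzero[OF half_periods_notin(1) z] by (simp add: karcher_zeta_eq)
    qed
    moreover have "r = Re v"
      using Re_v g' c half_periods_notin(1) by (simp add: r_def)
    ultimately show ?thesis
      by blast
  qed
  have "(THE r. \<forall>g\<in>paths_avoiding (poles s) w.
      \<exists>v. ((\<lambda>z. ?c * karcher_zeta \<omega>\<^sub>1 \<omega>\<^sub>2 z) has_contour_integral v) g \<and> r = Re v) = r"
  proof (rule the_equality)
    fix r'
    assume r': "\<forall>g\<in>paths_avoiding (poles s) w.
      \<exists>v. ((\<lambda>z. ?c * karcher_zeta \<omega>\<^sub>1 \<omega>\<^sub>2 z) has_contour_integral v) g \<and> r' = Re v"
    obtain g where g: "g \<in> paths_avoiding (poles s) w"
      using paths_avoiding_poles_nonempty[OF False] by blast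
    obtain v where "((\<lambda>z. ?c * karcher_zeta \<omega>\<^sub>1 \<omega>\<^sub>2 z) has_contour_integral v) g" "r = Re v"
      using int[OF g] by blast
    moreover obtain v' where
      "((\<lambda>z. ?c * karcher_zeta \<omega>\<^sub>1 \<omega>\<^sub>2 z) has_contour_integral v') g" "r' = Re v'"
      using r' g by blast
    ultimately show "r' = r"
      using has_contour_integral_unique by blast
  qed (use int in blast)
  then show ?thesis
    using False by (simp add: Z_fun_def karcher_poles_eq r_def scale_def)
qed (simp add: Z_fun_def karcher_poles_eq)

end

section \<open>The quadratic correction\<close>

text \<open>The increment of a quadratic form under 2 h is linear in z + h, so comparing
  coefficients gives four equations for three unknowns. \<open>A\<close> comes from the sum of the
  p-equations and \<open>B\<close> from the difference of the q-equations, while \<open>C\<close> is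
  determined twice; the hypothesis says that its two values agree.\<close>

lemma quadratic_form_increments:
  fixes a b p\<^sub>1 q\<^sub>1 p\<^sub>2 q\<^sub>2 :: real
  assumes "a \<noteq> 0" "b \<noteq> 0" and "p\<^sub>1 * a + q\<^sub>1 * b = p\<^sub>2 * a - q\<^sub>2 * b"
  obtains A B C where
    "\<And>x y. A * (x + 2 * a)\<^sup>2 + B * (y - 2 * b)\<^sup>2 + C * (x + 2 * a) * (y - 2 * b)
             = A * x\<^sup>2 + B * y\<^sup>2 + C * x * y - (p\<^sub>1 * (x + a) + q\<^sub>1 * (y - b))"
    "\<And>x y. A * (x + 2 * a)\<^sup>2 + B * (y + 2 * b)\<^sup>2 + C * (x + 2 * a) * (y + 2 * b)
             = A * x\<^sup>2 + B * y\<^sup>2 + C * x * y - (p\<^sub>2 * (x + a) + q\<^sub>2 * (y + b))"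
proof -
  define A where "A = - (p\<^sub>1 + p\<^sub>2) / (8 * a)"
  define B where "B = (q\<^sub>1 - q\<^sub>2) / (8 * b)"
  define C where "C = (p\<^sub>1 - p\<^sub>2) / (4 * b)"
  have C': "C = - (q\<^sub>1 + q\<^sub>2) / (4 * a)"
    using assms by (simp add: C_def field_simps)
  have p: "p\<^sub>1 = 2 * b * C - 4 * a * A" "p\<^sub>2 = - 2 * b * C - 4 * a * A"
    using assms(1,2) by (simp_all add: A_def C_def field_simps)
  have q: "q\<^sub>1 = 4 * b * B - 2 * a * C" "q\<^sub>2 = - 4 * b * B - 2 * a * C"
    using assms(1,2) by (simp_all add: B_def C' field_simps)
  show ?thesis
    by (rule that[of A B C]) (simp_all add: p q power2_eq_square algebra_simps)
qed

theorem theorem2p1: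
  fixes a b :: real and \<omega>\<^sub>1 \<omega>\<^sub>2 :: complex
  assumes "a > 0" and "b > 0"
    and "\<omega>\<^sub>1 = of_real a - \<i> * of_real b"
    and "\<omega>\<^sub>2 = of_real a + \<i> * of_real b"
  shows "\<exists>!ABC :: real \<times> real \<times> real. case ABC of (A, B, C) \<Rightarrow>
           range (Z_hat \<omega>\<^sub>1 \<omega>\<^sub>2 A B C) \<subseteq> R_hat \<and>
           real_analytic_on (\<lambda>z. real_of_ereal (Z_hat \<omega>\<^sub>1 \<omega>\<^sub>2 A B C z))
             {z. Z_hat \<omega>\<^sub>1 \<omega>\<^sub>2 A B C z \<noteq> \<infinity>} \<and>
           (\<forall>z. Z_hat \<omega>\<^sub>1 \<omega>\<^sub>2 A B C (z + 2 * \<omega>\<^sub>1) = Z_hat \<omega>\<^sub>1 \<omega>\<^sub>2 A B C z) \<and>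
           (\<forall>z. Z_hat \<omega>\<^sub>1 \<omega>\<^sub>2 A B C (z + 2 * \<omega>\<^sub>2) = Z_hat \<omega>\<^sub>1 \<omega>\<^sub>2 A B C z)"
proof -
  interpret rhombic_lattice a b \<omega>\<^sub>1 \<omega>\<^sub>2
    by unfold_locales (fact assms)+
  define P where "P = poles s"
  define U where "U z = scale * ln (norm (ksigma s e z))" for z
  define Q where "Q A B C z = A * (Re z)\<^sup>2 + B * (Im z)\<^sup>2 + C * Re z * Im z" for A B C z
  have Z: "Z_hat \<omega>\<^sub>1 \<omega>\<^sub>2 A B C z = (if z \<in> P then \<infinity> else ereal (U z + Q A B C z))" for A B C z
    by (simp add: Z_hat_def Z_fun_eq P_def U_def Q_def)
  have P_add [simp]: "z + 2 * \<omega>\<^sub>1 \<in> P \<longleftrightarrow> z \<in> P" "z + 2 * \<omega>\<^sub>2 \<in> P \<longleftrightarrow> z \<in> P" for z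
    using half_periods by (simp_all add: P_def add_mem_poles_iff)
  have zero_notin [simp]: "0 \<notin> P"
    by (simp add: P_def zero_notin_poles half_periods_notin)
  have periods_notin: "2 * \<omega>\<^sub>1 \<notin> P" "2 * \<omega>\<^sub>2 \<notin> P"
    using P_add[of 0] by simp_all
  have range: "range (Z_hat \<omega>\<^sub>1 \<omega>\<^sub>2 A B C) \<subseteq> R_hat" for A B C
    by (auto simp: Z R_hat_def)
  have finite_set: "{z. Z_hat \<omega>\<^sub>1 \<omega>\<^sub>2 A B C z \<noteq> \<infinity>} = - P" for A B C
    by (auto simp: Z)
  have analytic: "real_analytic_on (\<lambda>z. real_of_ereal (Z_hat \<omega>\<^sub>1 \<omega>\<^sub>2 A B C z)) (- P)" for A B C
  proof -
    have "real_analytic_on (\<lambda>z. U z + Q A B C z) (- P)"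
      unfolding U_def Q_def P_def
      by (intro real_analytic_on_add real_analytic_on_cmult real_analytic_on_ln_norm
          real_analytic_on_quadratic open_Compl_poles ksigma_holomorphic ksigma_nonzero
          half_periods_notin) simp_all
    moreover have "real_of_ereal (Z_hat \<omega>\<^sub>1 \<omega>\<^sub>2 A B C z) = U z + Q A B C z" if "z \<in> - P" for z
      using that by (simp add: Z)
    ultimately show ?thesis
      by (rule real_analytic_on_cong)
  qed
  \<comment> \<open>The pole set is invariant under both periods, so at a pole both sides are
    \<infinity> and only the finite values have to be compared.\<close>
  have periodic_iff: "(\<forall>z. Z_hat \<omega>\<^sub>1 \<omega>\<^sub>2 A B C (z + 2 * h) = Z_hat \<omega>\<^sub>1 \<omega>\<^sub>2 A B C z) \<longleftrightarrow>
      (\<forall>z. z \<notin> P \<longrightarrow> U (z + 2 * h) + Q A B C (z + 2 * h) = U z + Q A B C z)"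
    if "h = \<omega>\<^sub>1 \<or> h = \<omega>\<^sub>2" for A B C h
    using that by (auto simp: Z)

  obtain \<eta>\<^sub>1 where "\<And>z. z \<notin> P \<Longrightarrow> ln (norm (ksigma s e (z + 2 * \<omega>\<^sub>1))) =
      ln (norm (ksigma s e z)) + Re (\<eta>\<^sub>1 * (z + \<omega>\<^sub>1))"
    using ln_ksigma_add_period[OF half_periods_notin(1) half_periods(3,1) half_periods_notin(2)]
    unfolding P_def by blast
  then have U1: "U (z + 2 * \<omega>\<^sub>1) = U z + scale * Re (\<eta>\<^sub>1 * (z + \<omega>\<^sub>1))" if "z \<notin> P" for z
    using that by (simp add: U_def distrib_left)
  obtain \<eta>\<^sub>2 where "\<And>z. z \<notin> P \<Longrightarrow> ln (norm (ksigma s e (z + 2 * \<omega>\<^sub>2))) =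
      ln (norm (ksigma s e z)) + Re (\<eta>\<^sub>2 * (z + \<omega>\<^sub>2))"
    using ln_ksigma_add_period[OF half_periods_notin(1) half_periods(3,2) half_periods_notin(3)]
    unfolding P_def by blast
  then have U2: "U (z + 2 * \<omega>\<^sub>2) = U z + scale * Re (\<eta>\<^sub>2 * (z + \<omega>\<^sub>2))" if "z \<notin> P" for z
    using that by (simp add: U_def distrib_left)
  define p\<^sub>1 q\<^sub>1 p\<^sub>2 q\<^sub>2 where "p\<^sub>1 = scale * Re \<eta>\<^sub>1" and "q\<^sub>1 = - scale * Im \<eta>\<^sub>1"
    and "p\<^sub>2 = scale * Re \<eta>\<^sub>2" and "q\<^sub>2 = - scale * Im \<eta>\<^sub>2"
  have U1': "U (z + 2 * \<omega>\<^sub>1) = U z + (p\<^sub>1 * (Re z + a) + q\<^sub>1 * (Im z - b))" if "z \<notin> P" for z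
    unfolding U1[OF that] by (simp add: p\<^sub>1_def q\<^sub>1_def Re_Im_half_periods algebra_simps)
  have U2': "U (z + 2 * \<omega>\<^sub>2) = U z + (p\<^sub>2 * (Re z + a) + q\<^sub>2 * (Im z + b))" if "z \<notin> P" for z
    unfolding U2[OF that] by (simp add: p\<^sub>2_def q\<^sub>2_def Re_Im_half_periods algebra_simps)
  \<comment> \<open>The real part of Legendre's relation.\<close>
  have "p\<^sub>1 * a + q\<^sub>1 * b = p\<^sub>2 * a - q\<^sub>2 * b"
    using U1'[OF zero_notin] U2'[OF zero_notin] U1'[OF periods_notin(2)] U2'[OF periods_notin(1)]
    by (simp add: Re_Im_half_periods algebra_simps)
  with assms(1,2) obtain A B C where
    Q1: "\<And>x y. A * (x + 2 * a)\<^sup>2 + B * (y - 2 * b)\<^sup>2 + C * (x + 2 * a) * (y - 2 * b)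
             = A * x\<^sup>2 + B * y\<^sup>2 + C * x * y - (p\<^sub>1 * (x + a) + q\<^sub>1 * (y - b))" and
    Q2: "\<And>x y. A * (x + 2 * a)\<^sup>2 + B * (y + 2 * b)\<^sup>2 + C * (x + 2 * a) * (y + 2 * b)
             = A * x\<^sup>2 + B * y\<^sup>2 + C * x * y - (p\<^sub>2 * (x + a) + q\<^sub>2 * (y + b))"
    using quadratic_form_increments[of a b p\<^sub>1 q\<^sub>1 p\<^sub>2 q\<^sub>2] by auto
  have per: "\<forall>z. z \<notin> P \<longrightarrow> U (z + 2 * \<omega>\<^sub>1) + Q A B C (z + 2 * \<omega>\<^sub>1) = U z + Q A B C z"
    "\<forall>z. z \<notin> P \<longrightarrow> U (z + 2 * \<omega>\<^sub>2) + Q A B C (z + 2 * \<omega>\<^sub>2) = U z + Q A B C z"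
    using Q1 Q2 by (simp_all add: U1' U2' Q_def Re_Im_half_periods)
  show ?thesis
  proof (rule ex1I[of _ "(A, B, C)"])
    show "case (A, B, C) of (A, B, C) \<Rightarrow>
           range (Z_hat \<omega>\<^sub>1 \<omega>\<^sub>2 A B C) \<subseteq> R_hat \<and>
           real_analytic_on (\<lambda>z. real_of_ereal (Z_hat \<omega>\<^sub>1 \<omega>\<^sub>2 A B C z))
             {z. Z_hat \<omega>\<^sub>1 \<omega>\<^sub>2 A B C z \<noteq> \<infinity>} \<and>
           (\<forall>z. Z_hat \<omega>\<^sub>1 \<omega>\<^sub>2 A B C (z + 2 * \<omega>\<^sub>1) = Z_hat \<omega>\<^sub>1 \<omega>\<^sub>2 A B C z) \<and>
           (\<forall>z. Z_hat \<omega>\<^sub>1 \<omega>\<^sub>2 A B C (z + 2 * \<omega>\<^sub>2) = Z_hat \<omega>\<^sub>1 \<omega>\<^sub>2 A B C z)"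
      using range analytic per periodic_iff[of \<omega>\<^sub>1] periodic_iff[of \<omega>\<^sub>2] by (simp add: finite_set)
  next
    fix ABC :: "real \<times> real \<times> real"
    obtain A' B' C' where ABC: "ABC = (A', B', C')"
      by (cases ABC)
    assume "case ABC of (A, B, C) \<Rightarrow>
           range (Z_hat \<omega>\<^sub>1 \<omega>\<^sub>2 A B C) \<subseteq> R_hat \<and>
           real_analytic_on (\<lambda>z. real_of_ereal (Z_hat \<omega>\<^sub>1 \<omega>\<^sub>2 A B C z))
             {z. Z_hat \<omega>\<^sub>1 \<omega>\<^sub>2 A B C z \<noteq> \<infinity>} \<and>
           (\<forall>z. Z_hat \<omega>\<^sub>1 \<omega>\<^sub>2 A B C (z + 2 * \<omega>\<^sub>1) = Z_hat \<omega>\<^sub>1 \<omega>\<^sub>2 A B C z) \<and>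
           (\<forall>z. Z_hat \<omega>\<^sub>1 \<omega>\<^sub>2 A B C (z + 2 * \<omega>\<^sub>2) = Z_hat \<omega>\<^sub>1 \<omega>\<^sub>2 A B C z)"
    then have per': "\<forall>z. z \<notin> P \<longrightarrow> U (z + 2 * \<omega>\<^sub>1) + Q A' B' C' (z + 2 * \<omega>\<^sub>1) = U z + Q A' B' C' z"
      "\<forall>z. z \<notin> P \<longrightarrow> U (z + 2 * \<omega>\<^sub>2) + Q A' B' C' (z + 2 * \<omega>\<^sub>2) = U z + Q A' B' C' z"
      using periodic_iff[of \<omega>\<^sub>1] periodic_iff[of \<omega>\<^sub>2] by (simp_all add: ABC)
    \<comment> \<open>The part \<open>U\<close> cancels between the two periodic functions, so the
      difference of the quadratic forms is itself periodic off the poles.\<close>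
    define D where "D z = Q (A' - A) (B' - B) (C' - C) z" for z
    have D_eq: "D z = Q A' B' C' z - Q A B C z" for z
      by (simp add: D_def Q_def algebra_simps)
    have D1: "D (z + 2 * \<omega>\<^sub>1) = D z" and D2: "D (z + 2 * \<omega>\<^sub>2) = D z" if "z \<notin> P" for z
      using per per' that by (fastforce simp: D_eq)+
    \<comment> \<open>Translation starts at 0, where a quadratic form vanishes. The third point is
      the real number 4 a, which isolates the coefficient of x^2; the other two points differ only
      in the sign of the mixed term and so separate the remaining coefficients.\<close>
    have "D (2 * \<omega>\<^sub>1) = 0" "D (2 * \<omega>\<^sub>2) = 0" "D (2 * \<omega>\<^sub>2 + 2 * \<omega>\<^sub>1) = 0"
      using D1[of 0] D2[of 0] D1[OF periods_notin(2)] by (simp_all add: D_def Q_def)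
    then have eqs: "(A' - A) * (2 * a)\<^sup>2 + (B' - B) * (2 * b)\<^sup>2 - (C' - C) * (2 * a) * (2 * b) = 0"
      "(A' - A) * (2 * a)\<^sup>2 + (B' - B) * (2 * b)\<^sup>2 + (C' - C) * (2 * a) * (2 * b) = 0"
      "(A' - A) * (4 * a)\<^sup>2 = 0"
      by (simp_all add: D_def Q_def Re_Im_half_periods)
    then have "A' = A"
      using assms(1) by simp
    moreover from this have "(A' - A) * (2 * a)\<^sup>2 = 0"
      by simp
    with eqs have "(B' - B) * (2 * b)\<^sup>2 = 0" "(C' - C) * (2 * a) * (2 * b) = 0"
      by linarith+
    ultimately show "ABC = (A, B, C)"
      using assms(1,2) by (simp add: ABC)
  qed
qed

end
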